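(* Let $K=(K_{j\rho l\sigma})_{1\le j,l\le d;\ \rho,\sigma\in\mathcal{R}}$ be a real tensor and assume that $K_{j\rho l\sigma}=K_{l\sigma j\rho}$ for all $j,l,\rho,\sigma$. Then \begin{align*} \lambda_{\rm atom}(K)&=\inf\bigg\{\frac{h(k)}{\sum_{\rho\in\mathcal{R}}\big((1-\cos(\rho k))^2+\sin^2(\rho k)\big)}\colon k\in[0,2\pi)^d\setminus\{0\}\bigg\},\\ \tilde\lambda_{\rm LH}(K)&=\lim_{s\to0^+}\inf\bigg\{\frac{h(k)}{\sum_{\rho\in\mathcal{R}}\big((1-\cos(\rho k))^2+\sin^2(\rho k)\big)}\colon k\in(-s,s)^d\setminus\{0\}\bigg\}, \end{align*} where $h(k)$ is the smallest eigenvalue of $H(k)$. In particular, atomistic stability implies the Legendre–Hadamard condition, i.e. $\lambda_{\rm atom}(K)>0$ implies $\lambda_{\rm LH}(K)>0$.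
   Context: $\mathcal{R}\subset\mathbb{Z}^d\setminus\{0\}$ is a finite set with $\operatorname{span}_{\mathbb{Z}}\mathcal{R}=\mathbb{Z}^d$ and $\mathcal{R}=-\mathcal{R}$. $\rho k$ denotes the Euclidean scalar product. $K[A,B]=\sum_{j,l,\rho,\sigma}K_{j\rho l\sigma}A_{j\rho}B_{l\sigma}$ for $A,B\in\mathbb{R}^{d\times\mathcal{R}}$. $H(k)\in\mathbb{C}^{d\times d}$ is the (hermitian) matrix $$H(k)_{jl}=\sum_{\rho,\sigma\in\mathcal{R}}K_{j\rho l\sigma}\big(\cos(\rho k)-1+i\sin(\rho k)\big)\big(\cos(\sigma k)-1-i\sin(\sigma k)\big),\qquad k\in\mathbb{R}^d.$$ Legendre–Hadamard constants: with $L[A,B]=K[(A\rho)_{\rho\in\mathcal{R}},(B\rho)_{\rho\in\mathcal{R}}]$ for $A,B\in\mathbb{R}^{d\times d}$, $$\lambda_{\rm LH}(K)=\inf_{\xi,\eta\in\mathbb{R}^d\setminus\{0\}}\frac{L[\xi\otimes\eta,\xi\otimes\eta]}{|\xi|^2|\eta|^2},\qquad\tilde\lambda_{\rm LH}(K)=\inf_{\xi,\eta\in\mathbb{R}^d\setminus\{0\}}\frac{L[\xi\otimes\eta,\xi\otimes\eta]}{|\xi|^2\sum_{\rho\in\mathcal{R}}(\rho\eta)^2}.$$ Atomistic stability constant: $D_{\mathcal{R},\varepsilon}y(x)=\big(\frac{y(x+\varepsilon\rho)-y(x)}{\varepsilon}\big)_{\rho\in\mathcal{R}}$; $R_0=\max\{\max_{\rho\in\mathcal{R}}|\rho|,\sqrt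 d/4\}$; for an open, bounded, nonempty $\Omega\subset\mathbb{R}^d$, $\operatorname{sint}_\varepsilon\Omega=\{x\in\Omega\cap\varepsilon\mathbb{Z}^d:\operatorname{dist}(x,\partial\Omega)>\varepsilon R_0\}$ and $\mathcal{A}_\varepsilon(\Omega,0)$ is the set of $y\colon\Omega\cap\varepsilon\mathbb{Z}^d\to\mathbb{R}^d$ with $y(x)=0$ whenever $\operatorname{dist}(x,\partial\Omega)\le2\varepsilon R_0$; then $$\lambda_{\rm atom}(K)=\inf_{\varepsilon>0}\ \inf_{y\in\mathcal{A}_\varepsilon(\Omega,0),\,y\ne0}\frac{\sum_{x\in\operatorname{sint}_\varepsilon\Omega}K[D_{\mathcal{R},\varepsilon}y(x),D_{\mathcal{R},\varepsilon}y(x)]}{\sum_{x\in\operatorname{sint}_\varepsilon\Omega}|D_{\mathcal{R},\varepsilon}y(x)|^2},$$ which does not depend on the choice of $\Omega$. Atomistic stability means $\lambda_{\rm atom}(K)>0$; the Legendre–Hadamard condition means $\lambda_{\rm LH}(K)>0$. *)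

theory Defs
  imports "HOL-Analysis.Analysis"
begin

text \<open>
  The dimension \<open>d\<close> is \<open>CARD('n)\<close>. The interaction range \<open>R\<close> is a set of lattice vectors in
  \<open>real ^ 'n\<close>. An element \<open>A\<close> of the space of \<open>d \<times> R\<close> matrices is the map sending \<open>\<rho> \<in> R\<close> to its
  column \<open>A \<rho>\<close>, so that the entry in row \<open>j\<close> and column \<open>\<rho>\<close> is \<open>A \<rho> $ j\<close>; values outside \<open>R\<close>
  are never used. All infima are taken in the extended reals, where the infimum of the empty set
  is \<open>\<infinity>\<close>.
\<close>

type_synonym 'n rtensor = "'n \<Rightarrow> real ^ 'n \<Rightarrow> 'n \<Rightarrow> real ^ 'n \<Rightarrow> real"

definition int_lattice :: "(real ^ 'n::finite) set" where
  "int_lattice = {x. \<forall>i. x $ i \<in> \<int>}"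

definition int_span :: "(real ^ 'n::finite) set \<Rightarrow> (real ^ 'n) set" where
  "int_span = module.span (\<lambda>(c::int) v. real_of_int c *\<^sub>R v)"

lemma module_int_scaleR:
  "module (\<lambda>(c::int) (v :: real ^ 'n::finite). real_of_int c *\<^sub>R v)"
  by unfold_locales (simp_all add: algebra_simps)

lemma int_span_finite:
  assumes "finite S"
  shows "int_span S = range (\<lambda>c::real ^ 'n::finite \<Rightarrow> int. \<Sum>v\<in>S. real_of_int (c v) *\<^sub>R v)"
  unfolding int_span_def by (rule module.span_finite[OF module_int_scaleR assms])

definition interaction_range :: "(real ^ 'n::finite) set \<Rightarrow> bool" where
  "interaction_range R \<longleftrightarrow>
     finite R \<and> R \<subseteq> int_lattice - {0} \<and> int_span R = int_lattice \<and> R = uminus ` R"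

definition tensor_form ::
  "(real ^ 'n::finite) set \<Rightarrow> 'n rtensor \<Rightarrow>
   (real ^ 'n \<Rightarrow> real ^ 'n) \<Rightarrow> (real ^ 'n \<Rightarrow> real ^ 'n) \<Rightarrow> real" where
  "tensor_form R K A B =
     (\<Sum>j\<in>UNIV. \<Sum>l\<in>UNIV. \<Sum>\<rho>\<in>R. \<Sum>\<sigma>\<in>R. K j \<rho> l \<sigma> * A \<rho> $ j * B \<sigma> $ l)"


definition H_mat :: "(real ^ 'n::finite) set \<Rightarrow> 'n rtensor \<Rightarrow> real ^ 'n \<Rightarrow> complex ^ 'n ^ 'n" where
  "H_mat R K k = (\<chi> j l. \<Sum>\<rho>\<in>R. \<Sum>\<sigma>\<in>R. complex_of_real (K j \<rho> l \<sigma>)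
      * (complex_of_real (cos (\<rho> \<bullet> k)) - 1 + \<i> * complex_of_real (sin (\<rho> \<bullet> k)))
      * (complex_of_real (cos (\<sigma> \<bullet> k)) - 1 - \<i> * complex_of_real (sin (\<sigma> \<bullet> k))))"

definition is_eigenvalue :: "complex ^ 'n ^ 'n::finite \<Rightarrow> complex \<Rightarrow> bool" where
  "is_eigenvalue A \<mu> \<longleftrightarrow> (\<exists>v. v \<noteq> 0 \<and> A *v v = \<mu> *s v)"

text \<open>Intended for hermitian matrices, all of whose eigenvalues are real.\<close>

definition smallest_eigenvalue :: "complex ^ 'n ^ 'n::finite \<Rightarrow> real" where
  "smallest_eigenvalue A = Min {t. is_eigenvalue A (complex_of_real t)}"

definition h_min :: "(real ^ 'n::finite) set \<Rightarrow> 'n rtensor \<Rightarrow> real ^ 'n \<Rightarrow> real" where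
  "h_min R K k = smallest_eigenvalue (H_mat R K k)"

definition fourier_quotient :: "(real ^ 'n::finite) set \<Rightarrow> 'n rtensor \<Rightarrow> real ^ 'n \<Rightarrow> real" where
  "fourier_quotient R K k =
     h_min R K k / (\<Sum>\<rho>\<in>R. (1 - cos (\<rho> \<bullet> k))\<^sup>2 + (sin (\<rho> \<bullet> k))\<^sup>2)"


definition matrix_form ::
  "(real ^ 'n::finite) set \<Rightarrow> 'n rtensor \<Rightarrow> real ^ 'n ^ 'n \<Rightarrow> real ^ 'n ^ 'n \<Rightarrow> real" where
  "matrix_form R K A B = tensor_form R K (\<lambda>\<rho>. A *v \<rho>) (\<lambda>\<rho>. B *v \<rho>)"

definition outer :: "real ^ 'n \<Rightarrow> real ^ 'n \<Rightarrow> real ^ 'n ^ 'n::finite" where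
  "outer \<xi> \<eta> = (\<chi> i j. \<xi> $ i * \<eta> $ j)"

definition lambda_LH :: "(real ^ 'n::finite) set \<Rightarrow> 'n rtensor \<Rightarrow> ereal" where
  "lambda_LH R K = (INF \<xi>\<in>UNIV - {0}. INF \<eta>\<in>UNIV - {0}.
     ereal (matrix_form R K (outer \<xi> \<eta>) (outer \<xi> \<eta>) / ((norm \<xi>)\<^sup>2 * (norm \<eta>)\<^sup>2)))"

definition lambda_LH_tilde :: "(real ^ 'n::finite) set \<Rightarrow> 'n rtensor \<Rightarrow> ereal" where
  "lambda_LH_tilde R K = (INF \<xi>\<in>UNIV - {0}. INF \<eta>\<in>UNIV - {0}.
     ereal (matrix_form R K (outer \<xi> \<eta>) (outer \<xi> \<eta>) / ((norm \<xi>)\<^sup>2 * (\<Sum>\<rho>\<in>R. (\<rho> \<bullet> \<eta>)\<^sup>2))))"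


definition diff_quot :: "real \<Rightarrow> (real ^ 'n::finite \<Rightarrow> real ^ 'n) \<Rightarrow> real ^ 'n \<Rightarrow> real ^ 'n \<Rightarrow> real ^ 'n" where
  "diff_quot \<epsilon> y x = (\<lambda>\<rho>. (y (x + \<epsilon> *\<^sub>R \<rho>) - y x) /\<^sub>R \<epsilon>)"

definition range_radius :: "(real ^ 'n::finite) set \<Rightarrow> real" where
  "range_radius R = max (Max (norm ` R)) (sqrt (real CARD('n)) / 4)"

definition lattice_points :: "(real ^ 'n::finite) set \<Rightarrow> real \<Rightarrow> (real ^ 'n) set" where
  "lattice_points \<Omega> \<epsilon> = \<Omega> \<inter> (\<lambda>z. \<epsilon> *\<^sub>R z) ` int_lattice"

definition semi_interior ::
  "(real ^ 'n::finite) set \<Rightarrow> (real ^ 'n) set \<Rightarrow> real \<Rightarrow> (real ^ 'n) set" where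
  "semi_interior R \<Omega> \<epsilon> =
     {x \<in> lattice_points \<Omega> \<epsilon>. infdist x (frontier \<Omega>) > \<epsilon> * range_radius R}"

text \<open>
  Deformations are total functions of which only the restriction to \<^term>\<open>lattice_points \<Omega> \<epsilon>\<close> is
  relevant: for \<open>x\<close> in \<^term>\<open>semi_interior R \<Omega> \<epsilon>\<close> and \<open>\<rho> \<in> R\<close> the point \<open>x + \<epsilon> \<rho>\<close> lies in
  \<open>\<Omega>\<close> again. Accordingly \<open>y \<noteq> 0\<close> means being nonzero at some lattice point of \<open>\<Omega>\<close>.
\<close>

definition admissible ::
  "(real ^ 'n::finite) set \<Rightarrow> (real ^ 'n) set \<Rightarrow> real \<Rightarrow> (real ^ 'n \<Rightarrow> real ^ 'n) set" where
  "admissible R \<Omega> \<epsilon> = {y. \<forall>x\<in>lattice_points \<Omega> \<epsilon>.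
     infdist x (frontier \<Omega>) \<le> 2 * \<epsilon> * range_radius R \<longrightarrow> y x = 0}"

definition lambda_atom :: "(real ^ 'n::finite) set \<Rightarrow> (real ^ 'n) set \<Rightarrow> 'n rtensor \<Rightarrow> ereal" where
  "lambda_atom R \<Omega> K =
     (INF \<epsilon>\<in>{0<..}. INF y\<in>{y \<in> admissible R \<Omega> \<epsilon>. \<exists>x\<in>lattice_points \<Omega> \<epsilon>. y x \<noteq> 0}.
        ereal ((\<Sum>x\<in>semi_interior R \<Omega> \<epsilon>. tensor_form R K (diff_quot \<epsilon> y x) (diff_quot \<epsilon> y x))
             / (\<Sum>x\<in>semi_interior R \<Omega> \<epsilon>. \<Sum>\<rho>\<in>R. (norm (diff_quot \<epsilon> y x \<rho>))\<^sup>2)))"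

end

theory Submission
  imports Defs
begin

text \<open>
  Every constant in the theorem is an infimum of quotients of the form ``quadratic form over squared
  norm''. Subtracting \<open>c\<close> times the identity from \<open>K\<close> reduces each lower bound \<open>c \<le> \<dots>\<close> to the
  nonnegativity of a quadratic form. For the Fourier quotient this form is
  \<open>w \<mapsto> K[w \<otimes> a(k), w \<otimes> a(k)]\<close> with the symbol \<open>a(k)\<^sub>\<rho> = exp (\<i> \<rho> k) - 1\<close>, because the least eigenvalue
  of a hermitian matrix is the minimum of its Rayleigh quotient. For \<open>\<lambda>\<close> atom it is the energy of finitely
  supported lattice functions, since after rescaling and translation any of these fits into \<open>\<Omega>\<close>.
  The two are equivalent by Plancherel and by testing with truncated plane waves. Linearising
  the symbol at \<open>k = 0\<close> gives the Legendre--Hadamard form.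
\<close>

section \<open>The smallest eigenvalue as a minimal Rayleigh quotient\<close>

text \<open>The subtraction of c is possible because every denominator is, up to positive factors,
  the squared norm of the very matrix in the numerator: the columns are difference quotients,
  symbols times w, or (\<rho> \<bullet> \<eta>) \<xi>. This is why the limit at k = 0 yields the
  constant normalised by the sum of the (\<rho> \<bullet> \<eta>)^2; the other Legendre--Hadamard
  constant is reached by comparing normalisations. Two mismatches shape the proof. Eigenvectors are
  complex while deformations are real; they are bridged by the real tensor, whose form splits over
  real and imaginary parts. And the quotient degenerates to 0/0 where all symbols vanish; for
  coordinates below 2 \<pi> in modulus this happens only at k = 0, because R generates the lattice
  over the integers. The Fourier side is sampled on a finite grid of frequencies, so orthogonality
  is a finite sum and no integral over the cube occurs. The limit at 0 is not a continuity argument,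
  as the quotient generally depends on the direction of approach; a margin between two thresholds
  absorbs the linearisation error uniformly in direction.\<close>

lemma selfadjoint_min_eigenvector:
  fixes f :: "'a::euclidean_space \<Rightarrow> 'a"
  assumes f: "linear f" and sa: "\<And>v w. f v \<bullet> w = v \<bullet> f w"
  obtains m v where "v \<noteq> 0" "f v = m *\<^sub>R v" "\<And>w. m * (w \<bullet> w) \<le> f w \<bullet> w"
proof -
  have "continuous_on (sphere 0 1) (\<lambda>v. f v \<bullet> v)"
    by (intro continuous_intros linear_continuous_on) (use f in \<open>simp add: linear_conv_bounded_linear\<close>)
  moreover have "sphere (0::'a) 1 \<noteq> {}" by simp
  ultimately obtain v where v: "v \<in> sphere 0 1" and min: "\<And>w. w \<in> sphere 0 1 \<Longrightarrow> f v \<bullet> v \<le> f w \<bullet> w"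
    using continuous_attains_inf[OF compact_sphere] by blast
  define m where "m = f v \<bullet> v"
  have vv: "v \<bullet> v = 1" using v by (simp add: dot_square_norm)
  have ge: "m * (w \<bullet> w) \<le> f w \<bullet> w" for w
  proof (cases "w = 0")
    case False
    then have "inverse (norm w) *\<^sub>R w \<in> sphere 0 1" by simp
    from min[OF this] have "m \<le> (inverse (norm w))\<^sup>2 * (f w \<bullet> w)"
      by (simp add: m_def linear_scale[OF f] power2_eq_square algebra_simps)
    then show ?thesis using False by (simp add: dot_square_norm field_simps)
  qed simp
  have "f v = m *\<^sub>R v"
  proof -
    \<comment> \<open>The minimiser is critical. Moving from v in the direction of the residual u
      changes the shifted form by 2 t |u|^2 + t^2 q, which can stay nonnegative for all t only if u
      = 0.\<close>
    define u where "u = f v - m *\<^sub>R v"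
    define q where "q = f u \<bullet> u - m * (u \<bullet> u)"
    have pos: "0 \<le> 2 * t * (u \<bullet> u) + t\<^sup>2 * q" for t
    proof -
      have "f (v + t *\<^sub>R u) \<bullet> (v + t *\<^sub>R u) - m * ((v + t *\<^sub>R u) \<bullet> (v + t *\<^sub>R u))
          = (f v \<bullet> v - m * (v \<bullet> v)) + 2 * t * ((f v - m *\<^sub>R v) \<bullet> u) + t\<^sup>2 * q"
      proof -
        have "f u \<bullet> v = f v \<bullet> u" "u \<bullet> v = v \<bullet> u"
          using sa[of u v] by (simp_all only: inner_commute)
        then show ?thesis
          by (simp add: q_def linear_add[OF f] linear_scale[OF f] inner_add_left inner_add_right
              inner_diff_left power2_eq_square algebra_simps)
      qed
      with ge[of "v + t *\<^sub>R u"] show ?thesis by (simp add: vv m_def[symmetric] u_def[symmetric])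
    qed
    have "u \<bullet> u \<le> 0"
    proof (rule ccontr)
      assume "\<not> u \<bullet> u \<le> 0"
      then have p: "u \<bullet> u > 0" by (simp only: not_le)
      \<comment> \<open>A small negative t for which the linear term beats the quadratic one. The
        denominator is positive and dominates q whatever the sign of q.\<close>
      define t where "t = - (u \<bullet> u) / (\<bar>q\<bar> + 1)"
      have t: "t * (\<bar>q\<bar> + 1) = - (u \<bullet> u)" by (simp add: t_def add_nonneg_eq_0_iff)
      have "t\<^sup>2 * q \<le> t\<^sup>2 * (\<bar>q\<bar> + 1)" by (intro mult_left_mono) auto
      also have "\<dots> = - t * (u \<bullet> u)" using t by (simp add: power2_eq_square mult.assoc)
      finally have "0 \<le> t * (u \<bullet> u)" using pos[of t] by simp
      moreover have "t < 0" using p by (simp add: t_def divide_neg_pos)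
      ultimately show False using p by (simp add: mult_neg_pos zero_le_mult_iff)
    qed
    then have "u = 0" using inner_gt_zero_iff[of u] by linarith
    then show ?thesis by (simp add: u_def)
  qed
  with v ge show ?thesis by (intro that[of v m]) auto
qed

text \<open>Complex vectors are treated as a real Euclidean space whose inner product is the real
  part of the hermitian one. There a real multiple is multiplication by a real eigenvalue, so the
  real minimiser of the Rayleigh quotient is a complex eigenvector.\<close>

lemma le_smallest_eigenvalue_iff:
  fixes A :: "complex ^ 'n ^ 'n::finite"
  assumes sa: "\<And>v w. (A *v v) \<bullet> w = v \<bullet> (A *v w)"
  shows "c \<le> smallest_eigenvalue A \<longleftrightarrow> (\<forall>v. c * (v \<bullet> v) \<le> (A *v v) \<bullet> v)"
proof -
  have scale: "complex_of_real t *s v = t *\<^sub>R v" for t and v :: "complex ^ 'n"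
    by (simp add: vec_eq_iff complex_eq_iff)
  have lin: "linear ((*v) A)"
    by (rule linearI) (simp_all add: vec.add vec.scale flip: scale)
  define E where "E = {t. is_eigenvalue A (complex_of_real t)}"
  have E_iff: "t \<in> E \<longleftrightarrow> (\<exists>v. v \<noteq> 0 \<and> A *v v = t *\<^sub>R v)" for t
    by (simp add: E_def is_eigenvalue_def scale)
  obtain m v where v: "v \<noteq> 0" "A *v v = m *\<^sub>R v" and m: "\<And>w. m * (w \<bullet> w) \<le> (A *v w) \<bullet> w"
    using selfadjoint_min_eigenvector[OF lin sa] by metis
  have "m \<in> E" using v E_iff by blast
  have min: "m \<le> t" if "t \<in> E" for t
  proof -
    from that obtain w where w: "w \<noteq> 0" "A *v w = t *\<^sub>R w" using E_iff by blast
    with m[of w] show ?thesis by simp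
  qed
  \<comment> \<open>\<open>Min\<close> has its meaning only on finite nonempty sets. Eigenvectors
    for different real eigenvalues are orthogonal, and a finite-dimensional space holds finitely
    many of them.\<close>
  have "finite E"
  proof -
    obtain e where e: "\<And>t. t \<in> E \<Longrightarrow> e t \<noteq> 0 \<and> A *v e t = t *\<^sub>R e t"
      using E_iff by metis
    have orth: "e s \<bullet> e t = 0" if "s \<in> E" "t \<in> E" "s \<noteq> t" for s t
      using sa[of "e s" "e t"] e[OF that(1)] e[OF that(2)] that(3) by simp
    have "inj_on e E"
      using orth e by (metis inj_onI inner_eq_zero_iff)
    moreover have "pairwise orthogonal (e ` E)"
      unfolding pairwise_def orthogonal_def using orth by blast
    ultimately show ?thesis
      using pairwise_orthogonal_imp_finite finite_imageD by blast
  qed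
  then have "smallest_eigenvalue A = m"
    using \<open>m \<in> E\<close> min unfolding smallest_eigenvalue_def E_def[symmetric] by (intro Min_eqI) auto
  moreover have "c \<le> m \<longleftrightarrow> (\<forall>v. c * (v \<bullet> v) \<le> (A *v v) \<bullet> v)"
  proof
    assume "c \<le> m"
    then show "\<forall>v. c * (v \<bullet> v) \<le> (A *v v) \<bullet> v"
      using m by (meson inner_ge_zero mult_right_mono order_trans)
  next
    assume "\<forall>v. c * (v \<bullet> v) \<le> (A *v v) \<bullet> v"
    then have "c * (v \<bullet> v) \<le> m * (v \<bullet> v)" using v(2) by (metis inner_scaleR_left)
    with v(1) show "c \<le> m" by simp
  qed
  ultimately show ?thesis by simp
qed

section \<open>The symbol of the form\<close>

text \<open>The real part of the sesquilinear extension of \<open>tensor_form\<close>: the inner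
  product of complex numbers a and b is Re (a * cnj b).\<close>

definition cform ::
  "(real ^ 'n::finite) set \<Rightarrow> 'n rtensor \<Rightarrow>
   (real ^ 'n \<Rightarrow> complex ^ 'n) \<Rightarrow> (real ^ 'n \<Rightarrow> complex ^ 'n) \<Rightarrow> real" where
  "cform R K A B =
     (\<Sum>j\<in>UNIV. \<Sum>l\<in>UNIV. \<Sum>\<rho>\<in>R. \<Sum>\<sigma>\<in>R. K j \<rho> l \<sigma> * (A \<rho> $ j \<bullet> B \<sigma> $ l))"

lemma cform_eq_tensor_form:
  "cform R K A B = tensor_form R K (\<lambda>\<rho>. \<chi> j. Re (A \<rho> $ j)) (\<lambda>\<rho>. \<chi> j. Re (B \<rho> $ j))
     + tensor_form R K (\<lambda>\<rho>. \<chi> j. Im (A \<rho> $ j)) (\<lambda>\<rho>. \<chi> j. Im (B \<rho> $ j))"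
  by (simp add: cform_def tensor_form_def inner_complex_def algebra_simps flip: sum.distrib)

definition tensor_abs :: "(real ^ 'n::finite) set \<Rightarrow> 'n rtensor \<Rightarrow> real" where
  "tensor_abs R K = (\<Sum>j\<in>UNIV. \<Sum>l\<in>UNIV. \<Sum>\<rho>\<in>R. \<Sum>\<sigma>\<in>R. \<bar>K j \<rho> l \<sigma>\<bar>)"

lemma cform_diff_bound:
  assumes "\<And>j l \<rho> \<sigma>. \<rho> \<in> R \<Longrightarrow> \<sigma> \<in> R \<Longrightarrow>
     \<bar>A \<rho> $ j \<bullet> B \<sigma> $ l - A' \<rho> $ j \<bullet> B' \<sigma> $ l\<bar> \<le> M"
  shows "\<bar>cform R K A B - cform R K A' B'\<bar> \<le> tensor_abs R K * M"
proof -
  have "cform R K A B - cform R K A' B' = (\<Sum>j\<in>UNIV. \<Sum>l\<in>UNIV. \<Sum>\<rho>\<in>R. \<Sum>\<sigma>\<in>R.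
      K j \<rho> l \<sigma> * (A \<rho> $ j \<bullet> B \<sigma> $ l - A' \<rho> $ j \<bullet> B' \<sigma> $ l))"
    by (simp add: cform_def right_diff_distrib flip: sum_subtractf)
  also have "\<bar>\<dots>\<bar> \<le> (\<Sum>j\<in>UNIV. \<Sum>l\<in>UNIV. \<Sum>\<rho>\<in>R. \<Sum>\<sigma>\<in>R. \<bar>K j \<rho> l \<sigma>\<bar> * M)"
    using assms
    by (intro order_trans[OF sum_abs] sum_mono) (auto simp: abs_mult intro!: mult_left_mono)
  also have "\<dots> = tensor_abs R K * M"
    by (simp add: tensor_abs_def sum_distrib_right)
  finally show ?thesis .
qed

definition shift_tensor :: "'n rtensor \<Rightarrow> real \<Rightarrow> ('n::finite) rtensor" where
  "shift_tensor K c = (\<lambda>j \<rho> l \<sigma>. K j \<rho> l \<sigma> - (if j = l \<and> \<rho> = \<sigma> then c else 0))"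

lemma sum_if_diag:
  fixes g :: "'n::finite \<Rightarrow> 'n \<Rightarrow> 'a \<Rightarrow> 'a \<Rightarrow> real"
  assumes "finite R"
  shows "(\<Sum>j\<in>UNIV. \<Sum>l\<in>UNIV. \<Sum>\<rho>\<in>R. \<Sum>\<sigma>\<in>R. (if j = l \<and> \<rho> = \<sigma> then c else 0) * g j l \<rho> \<sigma>)
     = c * (\<Sum>\<rho>\<in>R. \<Sum>j\<in>UNIV. g j j \<rho> \<rho>)"
proof -
  have "(\<Sum>j\<in>UNIV. \<Sum>l\<in>UNIV. \<Sum>\<rho>\<in>R. \<Sum>\<sigma>\<in>R. (if j = l \<and> \<rho> = \<sigma> then c else 0) * g j l \<rho> \<sigma>)
      = (\<Sum>j\<in>UNIV. \<Sum>l\<in>UNIV. if j = l then c * (\<Sum>\<rho>\<in>R. g j l \<rho> \<rho>) else 0)"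
    by (intro sum.cong refl) (simp add: assms sum_distrib_left if_distrib[of "\<lambda>x. x * _"] cong: if_cong)
  also have "\<dots> = (\<Sum>j\<in>UNIV. c * (\<Sum>\<rho>\<in>R. g j j \<rho> \<rho>))" by simp
  also have "\<dots> = c * (\<Sum>j\<in>UNIV. \<Sum>\<rho>\<in>R. g j j \<rho> \<rho>)" by (simp add: sum_distrib_left)
  finally show ?thesis by (subst sum.swap)
qed

lemma tensor_form_shift:
  assumes "finite R"
  shows "tensor_form R (shift_tensor K c) A A = tensor_form R K A A - c * (\<Sum>\<rho>\<in>R. (norm (A \<rho>))\<^sup>2)"
proof -
  have "(\<Sum>\<rho>\<in>R. (norm (A \<rho>))\<^sup>2) = (\<Sum>\<rho>\<in>R. \<Sum>j\<in>UNIV. A \<rho> $ j * A \<rho> $ j)"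
    by (simp add: power2_norm_eq_inner inner_vec_def)
  then show ?thesis
    by (simp add: tensor_form_def shift_tensor_def left_diff_distrib sum_subtractf mult.assoc
        sum_if_diag[OF assms, of c "\<lambda>j l \<rho> \<sigma>. A \<rho> $ j * A \<sigma> $ l"])
qed

lemma cform_shift:
  assumes "finite R"
  shows "cform R (shift_tensor K c) A A = cform R K A A - c * (\<Sum>\<rho>\<in>R. (norm (A \<rho>))\<^sup>2)"
proof -
  have "(\<Sum>\<rho>\<in>R. (norm (A \<rho>))\<^sup>2) = (\<Sum>\<rho>\<in>R. \<Sum>j\<in>UNIV. A \<rho> $ j \<bullet> A \<rho> $ j)"
    unfolding power2_norm_eq_inner by (simp only: inner_vec_def)
  then show ?thesis
    by (simp only: cform_def shift_tensor_def left_diff_distrib sum_subtractf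
        sum_if_diag[OF assms, of c "\<lambda>j l \<rho> \<sigma>. A \<rho> $ j \<bullet> A \<sigma> $ l"])
qed

definition symb :: "real ^ 'n::finite \<Rightarrow> real ^ 'n \<Rightarrow> complex" where
  "symb k \<rho> = cis (\<rho> \<bullet> k) - 1"

lemma norm_symb_square: "(norm (symb k \<rho>))\<^sup>2 = (1 - cos (\<rho> \<bullet> k))\<^sup>2 + (sin (\<rho> \<bullet> k))\<^sup>2"
  by (simp add: symb_def cmod_power2 power2_commute)

lemma norm_vector_smult: "norm (s *s w) = norm s * norm (w :: complex ^ 'n)"
  by (simp add: norm_vec_def L2_set_def norm_mult power_mult_distrib real_sqrt_mult flip: sum_distrib_left)

definition symb_nonneg :: "(real ^ 'n::finite) set \<Rightarrow> 'n rtensor \<Rightarrow> real ^ 'n \<Rightarrow> bool" where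
  "symb_nonneg R K k \<longleftrightarrow> (\<forall>w. 0 \<le> cform R K (\<lambda>\<rho>. symb k \<rho> *s w) (\<lambda>\<rho>. symb k \<rho> *s w))"

lemma H_mat_symb:
  "H_mat R K k $ j $ l = (\<Sum>\<rho>\<in>R. \<Sum>\<sigma>\<in>R. of_real (K j \<rho> l \<sigma>) * symb k \<rho> * cnj (symb k \<sigma>))"
proof -
  have "complex_of_real (cos (\<rho> \<bullet> k)) - 1 + \<i> * complex_of_real (sin (\<rho> \<bullet> k)) = symb k \<rho>"
    "complex_of_real (cos (\<rho> \<bullet> k)) - 1 - \<i> * complex_of_real (sin (\<rho> \<bullet> k)) = cnj (symb k \<rho>)" for \<rho>
    by (simp_all add: symb_def complex_eq_iff)
  then show ?thesis by (simp add: H_mat_def)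
qed

lemma inner_complex_cnj_left: "(cnj h * x) \<bullet> y = x \<bullet> (h * y)" for x y h :: complex
  by (simp add: inner_complex_def algebra_simps)

text \<open>Exchanging the summation indices \<rho> and \<sigma> turns the symmetry of K into
  conjugate symmetry of the entries.\<close>

lemma H_mat_selfadjoint:
  assumes sym: "\<And>j l \<rho> \<sigma>. \<rho> \<in> R \<Longrightarrow> \<sigma> \<in> R \<Longrightarrow> K j \<rho> l \<sigma> = K l \<sigma> j \<rho>"
  shows "(H_mat R K k *v v) \<bullet> w = v \<bullet> (H_mat R K k *v w)"
proof -
  have herm: "H_mat R K k $ j $ l = cnj (H_mat R K k $ l $ j)" for j l
    unfolding H_mat_symb by (subst sum.swap) (auto intro!: sum.cong simp: sym mult_ac)
  have "(H_mat R K k *v v) \<bullet> w = (\<Sum>j\<in>UNIV. \<Sum>l\<in>UNIV. (H_mat R K k $ j $ l * v $ l) \<bullet> w $ j)"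
    by (simp add: inner_vec_def matrix_vector_mult_def inner_sum_left)
  also have "\<dots> = (\<Sum>l\<in>UNIV. \<Sum>j\<in>UNIV. v $ l \<bullet> (H_mat R K k $ l $ j * w $ j))"
    by (subst sum.swap, subst herm) (simp only: inner_complex_cnj_left)
  also have "\<dots> = v \<bullet> (H_mat R K k *v w)"
    by (simp add: inner_vec_def matrix_vector_mult_def inner_sum_right)
  finally show ?thesis .
qed

text \<open>The row index j comes with the unconjugated symbol of \<rho>, whereas the inner product
  pairs it with the conjugate of \<open>v $ j\<close>. Collecting the factors of j therefore puts
  the conjugate of v into the form.\<close>

lemma H_mat_form:
  "(H_mat R K k *v v) \<bullet> v
     = cform R K (\<lambda>\<rho>. symb k \<rho> *s (\<chi> j. cnj (v $ j))) (\<lambda>\<rho>. symb k \<rho> *s (\<chi> j. cnj (v $ j)))"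
proof -
  have t: "(of_real r * s * cnj t * x) \<bullet> y = r * ((s * cnj y) \<bullet> (t * cnj x))" for r s t x y
    by (simp add: inner_complex_def algebra_simps)
  have "(H_mat R K k *v v) \<bullet> v = (\<Sum>j\<in>UNIV. \<Sum>l\<in>UNIV. (H_mat R K k $ j $ l * v $ l) \<bullet> v $ j)"
    by (simp add: inner_vec_def matrix_vector_mult_def inner_sum_left)
  also have "\<dots> = (\<Sum>j\<in>UNIV. \<Sum>l\<in>UNIV. \<Sum>\<rho>\<in>R. \<Sum>\<sigma>\<in>R.
      (of_real (K j \<rho> l \<sigma>) * symb k \<rho> * cnj (symb k \<sigma>) * v $ l) \<bullet> v $ j)"
    by (simp only: H_mat_symb sum_distrib_right inner_sum_left)
  finally show ?thesis
    by (simp only: t cform_def vector_smult_component vec_lambda_beta)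
qed

lemma le_fourier_quotient_iff:
  assumes fin: "finite R" and ne: "\<exists>\<rho>\<in>R. symb k \<rho> \<noteq> 0"
    and sym: "\<And>j l \<rho> \<sigma>. \<rho> \<in> R \<Longrightarrow> \<sigma> \<in> R \<Longrightarrow> K j \<rho> l \<sigma> = K l \<sigma> j \<rho>"
  shows "c \<le> fourier_quotient R K k \<longleftrightarrow> symb_nonneg R (shift_tensor K c) k"
proof -
  define D where "D = (\<Sum>\<rho>\<in>R. (norm (symb k \<rho>))\<^sup>2)"
  define q where "q w = cform R K (\<lambda>\<rho>. symb k \<rho> *s w) (\<lambda>\<rho>. symb k \<rho> *s w)" for w
  have "D > 0"
  proof -
    obtain \<rho> where "\<rho> \<in> R" "symb k \<rho> \<noteq> 0" using ne by blast
    then show ?thesis unfolding D_def by (intro sum_pos2[OF fin]) auto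
  qed
  have "c \<le> fourier_quotient R K k \<longleftrightarrow> c * D \<le> h_min R K k"
    using \<open>D > 0\<close> by (simp add: fourier_quotient_def D_def norm_symb_square pos_le_divide_eq)
  also have "\<dots> \<longleftrightarrow> (\<forall>v. c * D * (v \<bullet> v) \<le> (H_mat R K k *v v) \<bullet> v)"
    unfolding h_min_def by (rule le_smallest_eigenvalue_iff) (rule H_mat_selfadjoint[OF sym])
  also have "\<dots> \<longleftrightarrow> (\<forall>v. c * D * (norm v)\<^sup>2 \<le> q (\<chi> j. cnj (v $ j)))"
    by (simp only: H_mat_form q_def dot_square_norm)
  \<comment> \<open>Conjugation is a norm-preserving involution, so the conjugated vectors range
    over all vectors.\<close>
  also have "\<dots> \<longleftrightarrow> (\<forall>w. c * D * (norm w)\<^sup>2 \<le> q w)"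
  proof -
    have n: "norm (\<chi> j. cnj (v $ j)) = norm v" for v :: "complex ^ 'a"
      by (simp add: norm_vec_def)
    have i: "(\<chi> j. cnj ((\<chi> j. cnj (v $ j)) $ j)) = v" for v :: "complex ^ 'a"
      by (simp add: vec_eq_iff)
    show ?thesis
    proof (intro iffI allI)
      fix w assume "\<forall>v. c * D * (norm v)\<^sup>2 \<le> q (\<chi> j. cnj (v $ j))"
      from spec[OF this, of "\<chi> j. cnj (w $ j)"] show "c * D * (norm w)\<^sup>2 \<le> q w"
        unfolding n i .
    next
      fix v assume "\<forall>w. c * D * (norm w)\<^sup>2 \<le> q w"
      from spec[OF this, of "\<chi> j. cnj (v $ j)"] show "c * D * (norm v)\<^sup>2 \<le> q (\<chi> j. cnj (v $ j))"
        unfolding n .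
    qed
  qed
  also have "\<dots> \<longleftrightarrow> symb_nonneg R (shift_tensor K c) k"
    by (simp add: symb_nonneg_def cform_shift[OF fin] q_def D_def norm_vector_smult
        power_mult_distrib mult.assoc flip: sum_distrib_right)
  finally show ?thesis .
qed

section \<open>Lattice boxes and orthogonality of characters on a finite grid\<close>

definition int_box :: "int \<Rightarrow> int \<Rightarrow> (real ^ 'n::finite) set" where
  "int_box a b = (\<lambda>f. \<chi> i. real_of_int (f i)) ` (UNIV \<rightarrow>\<^sub>E {a..<b})"

lemma int_box_iff:
  "z \<in> int_box a b \<longleftrightarrow> z \<in> int_lattice \<and> (\<forall>i. real_of_int a \<le> z $ i \<and> z $ i < real_of_int b)"
proof
  assume "z \<in> int_box a b"
  then show "z \<in> int_lattice \<and> (\<forall>i. real_of_int a \<le> z $ i \<and> z $ i < real_of_int b)"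
    by (force simp: int_box_def int_lattice_def PiE_iff)
next
  assume z: "z \<in> int_lattice \<and> (\<forall>i. real_of_int a \<le> z $ i \<and> z $ i < real_of_int b)"
  have fl: "real_of_int \<lfloor>z $ i\<rfloor> = z $ i" for i
    using z by (metis (mono_tags, lifting) Ints_cases floor_of_int int_lattice_def mem_Collect_eq)
  have eq: "z = (\<chi> i. real_of_int \<lfloor>z $ i\<rfloor>)"
    unfolding vec_eq_iff vec_lambda_beta by (rule allI) (rule fl[symmetric])
  have "a \<le> \<lfloor>z $ i\<rfloor> \<and> \<lfloor>z $ i\<rfloor> < b" for i
    using z fl[of i] by (metis of_int_le_iff of_int_less_iff)
  then have "(\<lambda>i. \<lfloor>z $ i\<rfloor>) \<in> UNIV \<rightarrow>\<^sub>E {a..<b}" by (simp add: PiE_iff)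
  from imageI[OF this, of "\<lambda>f. \<chi> i. real_of_int (f i)"] show "z \<in> int_box a b"
    unfolding int_box_def eq[symmetric] .
qed

lemma inj_int_vec: "inj_on (\<lambda>f. (\<chi> i. real_of_int (f i)) :: real ^ 'n::finite) A"
  by (auto simp: inj_on_def vec_eq_iff)

lemma finite_int_box [simp]: "finite (int_box a b)"
  by (simp add: int_box_def finite_PiE)

lemma card_int_box: "card (int_box a b :: (real ^ 'n::finite) set) = nat (b - a) ^ CARD('n)"
  by (simp add: int_box_def card_image inj_int_vec card_PiE)

lemma cis_sum: "finite A \<Longrightarrow> cis (\<Sum>i\<in>A. f i) = (\<Prod>i\<in>A. cis (f i))"
  by (induction A rule: finite_induct) (auto simp flip: cis_mult)

lemma cis_eq_1D: "cis x = 1 \<Longrightarrow> \<exists>n::int. x = 2 * pi * n"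
  by (metis cis.sel(1) cos_one_2pi_int one_complex.sel(1) mult.commute mult.assoc)

text \<open>A geometric sum with ratio \<omega> = exp (2 \<pi> \<i> m / N). Here \<omega>^N = 1, and
  \<omega> = 1 would make m a multiple of N, which 0 < |m| < N excludes.\<close>

lemma sum_roots_of_unity:
  fixes N :: nat and m :: int
  assumes "m \<noteq> 0" "\<bar>m\<bar> < int N"
  shows "(\<Sum>t\<in>{0..<int N}. cis (2 * pi / N * t * m)) = 0"
proof -
  have N: "N > 0" using assms by auto
  define \<omega> where "\<omega> = cis (2 * pi / N * m)"
  have "\<omega> \<noteq> 1"
  proof
    assume "\<omega> = 1"
    then obtain n :: int where "2 * pi / N * m = 2 * pi * n" unfolding \<omega>_def by (blast dest: cis_eq_1D)
    then have "real_of_int m = real_of_int (n * int N)" using N by (simp add: field_simps)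
    then have "m = n * int N" using of_int_eq_iff by blast
    then show False using assms by (auto simp: abs_mult)
  qed
  have "(\<Sum>t\<in>{0..<int N}. cis (2 * pi / N * t * m)) = (\<Sum>t\<in>{0..<N}. \<omega> ^ t)"
  proof -
    have i: "{0..<int N} = int ` {0..<N}" by (simp add: image_int_atLeastLessThan)
    show ?thesis unfolding i
      by (subst sum.reindex) (auto simp: \<omega>_def Complex.DeMoivre mult_ac intro!: sum.cong)
  qed
  also have "\<dots> = (\<omega> ^ N - 1) / (\<omega> - 1)"
    using \<open>\<omega> \<noteq> 1\<close> by (simp add: geometric_sum atLeast0LessThan)
  also have "\<omega> ^ N = cis (2 * pi * m)" using N by (simp add: \<omega>_def Complex.DeMoivre)
  also have "\<dots> = 1" by (simp add: cis_multiple_2pi)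
  finally show ?thesis by simp
qed

text \<open>Orthogonality of the characters of the group (Z/N)^d. The bound on the coordinates
  excludes aliasing: a nonzero m must not vanish modulo N.\<close>

lemma sum_cis_int_box:
  fixes m :: "real ^ 'n::finite"
  assumes m: "m \<in> int_lattice" "\<And>i. \<bar>m $ i\<bar> < real N"
  shows "(\<Sum>z\<in>int_box 0 (int N). cis (m \<bullet> ((2 * pi / N) *\<^sub>R z))) = (if m = 0 then of_nat N ^ CARD('n) else 0)"
proof (cases "m = 0")
  case True
  then show ?thesis by (simp add: card_int_box)
next
  case False
  then obtain i where i: "m $ i \<noteq> 0" by (auto simp: vec_eq_iff)
  define f where "f j = \<lfloor>m $ j\<rfloor>" for j
  have f: "real_of_int (f j) = m $ j" for j using m by (simp add: f_def int_lattice_def)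
  have "\<bar>real_of_int (f i)\<bar> < real N" using m(2)[of i] f by simp
  then have fi: "\<bar>f i\<bar> < int N" by linarith
  have "(\<Sum>z\<in>int_box 0 (int N). cis (m \<bullet> ((2 * pi / N) *\<^sub>R z)))
      = (\<Sum>g\<in>UNIV \<rightarrow>\<^sub>E {0..<int N}. cis (\<Sum>j\<in>UNIV. 2 * pi / N * g j * f j))"
    unfolding int_box_def
    by (subst sum.reindex[OF inj_int_vec])
      (auto simp: inner_vec_def f sum_distrib_left mult_ac intro!: sum.cong arg_cong[of _ _ cis])
  \<comment> \<open>A character factors over the coordinates and the box is a product of intervals,
    so the sum is a product of one-dimensional sums; the factor at i vanishes.\<close>
  also have "\<dots> = (\<Prod>j\<in>UNIV. \<Sum>t\<in>{0..<int N}. cis (2 * pi / N * t * f j))"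
    by (subst prod_sum_PiE) (auto simp: cis_sum)
  also have "\<dots> = 0"
  proof (rule prod_zero)
    have "f i \<noteq> 0" using i f[of i] by auto
    then show "\<exists>j\<in>UNIV. (\<Sum>t\<in>{0..<int N}. cis (2 * pi / N * t * f j)) = 0"
      using sum_roots_of_unity[OF _ fi] by blast
  qed simp
  finally show ?thesis using False by simp
qed

section \<open>Nonnegativity on the lattice and in Fourier space\<close>

definition cvec :: "real ^ 'n \<Rightarrow> complex ^ 'n::finite" where
  "cvec v = (\<chi> j. complex_of_real (v $ j))"

lemma cform_add_left: "cform R K (\<lambda>\<rho>. A \<rho> + A' \<rho>) B = cform R K A B + cform R K A' B"
  by (simp add: cform_def inner_add_left distrib_left sum.distrib)

lemma cform_add_right: "cform R K A (\<lambda>\<rho>. B \<rho> + B' \<rho>) = cform R K A B + cform R K A B'"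
  by (simp add: cform_def inner_add_right distrib_left sum.distrib)

lemma cform_zero: "cform R K (\<lambda>\<rho>. 0) B = 0" "cform R K A (\<lambda>\<rho>. 0) = 0"
  by (simp_all add: cform_def)

lemma cform_sum_left:
  "finite Z \<Longrightarrow> cform R K (\<lambda>\<rho>. \<Sum>z\<in>Z. A z \<rho>) B = (\<Sum>z\<in>Z. cform R K (A z) B)"
  by (induction Z rule: finite_induct) (simp_all add: cform_zero cform_add_left)

lemma cform_sum_right:
  "finite Z \<Longrightarrow> cform R K A (\<lambda>\<rho>. \<Sum>z\<in>Z. B z \<rho>) = (\<Sum>z\<in>Z. cform R K A (B z))"
  by (induction Z rule: finite_induct) (simp_all add: cform_zero cform_add_right)

lemma cform_cis_cvec:
  "cform R K (\<lambda>\<rho>. cis s *s cvec (A \<rho>)) (\<lambda>\<rho>. cis t *s cvec (B \<rho>)) = cos (s - t) * tensor_form R K A B"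
proof -
  have e: "(cis s * complex_of_real a) \<bullet> (cis t * complex_of_real b) = cos (s - t) * (a * b)" for a b
    by (simp add: inner_complex_def cos_diff algebra_simps)
  show ?thesis
    by (simp add: cform_def tensor_form_def cvec_def e sum_distrib_left mult_ac)
qed

text \<open>A common phase drops out, so a plane wave has the same energy density at every lattice
  point.\<close>

lemma cform_cis:
  "cform R K (\<lambda>\<rho>. cis s *s A \<rho>) (\<lambda>\<rho>. cis s *s B \<rho>) = cform R K A B"
proof -
  have e: "(cis s * a) \<bullet> (cis s * b) = a \<bullet> b" for a b
  proof -
    have "(cis s * a) \<bullet> (cis s * b) = ((cos s)\<^sup>2 + (sin s)\<^sup>2) * (a \<bullet> b)"
      unfolding inner_complex_def times_complex.sel cis.sel by algebra
    then show ?thesis by simp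
  qed
  show ?thesis by (simp add: cform_def e)
qed

text \<open>\<open>Z\<close> is any finite set containing every lattice point whose stencil,
  including the point itself, meets the support of \<open>u\<close>. Further points contribute zero,
  so the sum is the full lattice energy for each such \<open>Z\<close>, and every application can
  choose a convenient one.\<close>

definition lattice_stable :: "(real ^ 'n::finite) set \<Rightarrow> 'n rtensor \<Rightarrow> bool" where
  "lattice_stable R K \<longleftrightarrow>
     (\<forall>u Z. finite Z \<and> Z \<subseteq> int_lattice \<and>
        (\<forall>z\<in>int_lattice. \<forall>\<rho>\<in>insert 0 R. u (z + \<rho>) \<noteq> 0 \<longrightarrow> z \<in> Z) \<longrightarrow>
        0 \<le> (\<Sum>z\<in>Z. tensor_form R K (\<lambda>\<rho>. u (z + \<rho>) - u z) (\<lambda>\<rho>. u (z + \<rho>) - u z)))"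

lemma int_lattice_add: "x \<in> int_lattice \<Longrightarrow> y \<in> int_lattice \<Longrightarrow> x + y \<in> int_lattice"
  by (simp add: int_lattice_def)

lemma int_lattice_diff: "x \<in> int_lattice \<Longrightarrow> y \<in> int_lattice \<Longrightarrow> x - y \<in> int_lattice"
  by (simp add: int_lattice_def)

text \<open>Discrete Plancherel: averaging the symbol over the grid \<open>(2 \<pi> / N) {0..<N}\<^sup>d\<close> recovers the energy
  exactly as soon as \<open>N\<close> exceeds the diameter of the support.\<close>

lemma symb_nonneg_imp_lattice_stable:
  fixes R :: "(real ^ 'n::finite) set"
  assumes R: "R \<subseteq> int_lattice"
    and nonneg: "\<And>k. (\<forall>i. 0 \<le> k $ i \<and> k $ i < 2 * pi) \<Longrightarrow> symb_nonneg R K k"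
  shows "lattice_stable R K"
  unfolding lattice_stable_def
proof (intro allI impI, elim conjE)
  fix u :: "real ^ 'n \<Rightarrow> real ^ 'n" and Z :: "(real ^ 'n) set"
  assume Z: "finite Z" "Z \<subseteq> int_lattice"
    and supp: "\<forall>z\<in>int_lattice. \<forall>\<rho>\<in>insert 0 R. u (z + \<rho>) \<noteq> 0 \<longrightarrow> z \<in> Z"
  define G where "G z \<rho> = u (z + \<rho>) - u z" for z \<rho>
  \<comment> \<open>\<open>w k\<close> is the discrete Fourier transform of \<open>u\<close>, and
    \<open>c k \<rho>\<close> that of its difference in direction \<rho>. The shift rule should turn
    the difference into multiplication by \<open>symb k \<rho>\<close>.\<close>
  define c where "c k \<rho> = (\<Sum>z\<in>Z. cis (- (z \<bullet> k)) *s cvec (G z \<rho>))" for k \<rho>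
  define w where "w k = (\<Sum>z\<in>Z. cis (- (z \<bullet> k)) *s cvec (u z))" for k
  have c: "c k \<rho> = symb k \<rho> *s w k" if \<rho>: "\<rho> \<in> R" for k \<rho>
  proof -
    have "(\<Sum>z\<in>Z. cis (- (z \<bullet> k)) *s cvec (u (z + \<rho>)))
        = (\<Sum>z\<in>Z. cis (\<rho> \<bullet> k) *s (cis (- ((z + \<rho>) \<bullet> k)) *s cvec (u (z + \<rho>))))"
      by (simp add: vector_smult_assoc cis_mult inner_add_left)
    also have "\<dots> = (\<Sum>z\<in>(\<lambda>z. z + \<rho>) ` Z. cis (\<rho> \<bullet> k) *s (cis (- (z \<bullet> k)) *s cvec (u z)))"
      by (subst sum.reindex) auto
    \<comment> \<open>\<open>Z\<close> and its translate differ only at points where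
      \<open>u\<close> vanishes: the support condition is applied with stencil element 0 on one side
      and with \<rho> at z - \<rho> on the other.\<close>
    also have "\<dots> = (\<Sum>z\<in>Z. cis (\<rho> \<bullet> k) *s (cis (- (z \<bullet> k)) *s cvec (u z)))"
    proof (rule sum.mono_neutral_cong)
      fix z assume z: "z \<in> (\<lambda>z. z + \<rho>) ` Z - Z"
      then have "z \<in> int_lattice" using Z \<rho> R by (auto intro: int_lattice_add)
      with z supp have "u z = 0" by force
      then show "cis (\<rho> \<bullet> k) *s (cis (- (z \<bullet> k)) *s cvec (u z)) = 0" by (simp add: cvec_def vec_eq_iff)
    next
      fix z assume z: "z \<in> Z - (\<lambda>z. z + \<rho>) ` Z"
      then have "z - \<rho> \<notin> Z" by (metis DiffD2 diff_add_cancel imageI)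
      moreover have "z - \<rho> \<in> int_lattice" using z Z \<rho> R by (auto intro: int_lattice_diff)
      ultimately have "u (z - \<rho> + \<rho>) = 0" using supp \<rho> by blast
      then show "cis (\<rho> \<bullet> k) *s (cis (- (z \<bullet> k)) *s cvec (u z)) = 0" by (simp add: cvec_def vec_eq_iff)
    qed (use Z in auto)
    also have "\<dots> = cis (\<rho> \<bullet> k) *s w k"
      by (simp add: w_def vec.scale_sum_right)
    finally have "(\<Sum>z\<in>Z. cis (- (z \<bullet> k)) *s cvec (u (z + \<rho>))) = cis (\<rho> \<bullet> k) *s w k" .
    moreover have "cvec (G z \<rho>) = cvec (u (z + \<rho>)) - cvec (u z)" for z
      by (simp add: cvec_def G_def vec_eq_iff)
    ultimately show ?thesis
      by (simp add: c_def symb_def w_def vec.scale_right_diff_distrib vec.scale_left_diff_distrib sum_subtractf)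
  qed
  have ck: "0 \<le> cform R K (c k) (c k)" if "\<forall>i. 0 \<le> k $ i \<and> k $ i < 2 * pi" for k
  proof -
    have "cform R K (c k) (c k) = cform R K (\<lambda>\<rho>. symb k \<rho> *s w k) (\<lambda>\<rho>. symb k \<rho> *s w k)"
      unfolding cform_def by (intro sum.cong refl) (simp add: c)
    with nonneg[OF that] show ?thesis by (simp add: symb_nonneg_def)
  qed
  have cc: "cform R K (c k) (c k) = (\<Sum>z\<in>Z. \<Sum>z'\<in>Z. cos ((z' - z) \<bullet> k) * tensor_form R K (G z) (G z'))" for k
    unfolding c_def[abs_def]
    by (simp add: cform_sum_left[OF Z(1)] cform_sum_right[OF Z(1)] cform_cis_cvec inner_diff_left)
  obtain b where b: "\<And>z. z \<in> Z \<Longrightarrow> norm z \<le> b"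
    using finite_imp_bounded[OF Z(1)] by (auto simp: bounded_iff)
  \<comment> \<open>Coordinates of differences of two points of \<open>Z\<close> are at most 2 b in
    modulus, so N must exceed 2 b strictly; the added 1 also keeps N positive in every case.\<close>
  define N where "N = nat \<lceil>2 * b\<rceil> + 1"
  have N: "N > 0" "2 * b < real N" unfolding N_def by linarith+
  have orth: "(\<Sum>x\<in>int_box 0 (int N). cos ((z' - z) \<bullet> ((2 * pi / N) *\<^sub>R x)))
      = (if z = z' then real N ^ CARD('n) else 0)" if "z \<in> Z" "z' \<in> Z" for z z'
  proof -
    have "\<bar>(z' - z) $ i\<bar> < real N" for i
      using component_le_norm_cart[of "z' - z" i] norm_triangle_ineq4[of z' z] b[OF that(1)] b[OF that(2)] N
      by linarith
    from sum_cis_int_box[OF _ this] that Z(2)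
    have "(\<Sum>x\<in>int_box 0 (int N). cis ((z' - z) \<bullet> ((2 * pi / N) *\<^sub>R x)))
      = (if z' - z = 0 then of_nat N ^ CARD('n) else 0)"
      by (blast intro: int_lattice_diff)
    from arg_cong[OF this, of Re] show ?thesis
      by (simp split: if_splits flip: of_nat_power)
  qed
  \<comment> \<open>All grid frequencies lie in the half-open cube of the hypothesis. Exchanging the
    sums then leaves only the diagonal pairs, that is, the lattice energy.\<close>
  have "0 \<le> (\<Sum>x\<in>int_box 0 (int N). cform R K (c ((2 * pi / N) *\<^sub>R x)) (c ((2 * pi / N) *\<^sub>R x)))"
    using N by (intro sum_nonneg ck) (auto simp: int_box_iff field_simps)
  also have "\<dots> = (\<Sum>z\<in>Z. \<Sum>z'\<in>Z. (\<Sum>x\<in>int_box 0 (int N). cos ((z' - z) \<bullet> ((2 * pi / N) *\<^sub>R x)))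
      * tensor_form R K (G z) (G z'))"
    unfolding cc sum_distrib_right by (subst sum.swap, rule sum.cong[OF refl], rule sum.swap)
  also have "\<dots> = (\<Sum>z\<in>Z. \<Sum>z'\<in>Z. if z = z' then real N ^ CARD('n) * tensor_form R K (G z) (G z') else 0)"
    by (intro sum.cong refl) (simp only: orth if_distrib[of "\<lambda>x. x * _"] mult_zero_left)
  also have "\<dots> = real N ^ CARD('n) * (\<Sum>z\<in>Z. tensor_form R K (G z) (G z))"
    by (simp add: Z sum_distrib_left)
  finally have "0 \<le> real N ^ CARD('n) * (\<Sum>z\<in>Z. tensor_form R K (G z) (G z))" .
  moreover have "0 < real N ^ CARD('n)" using N by simp
  ultimately have "0 \<le> (\<Sum>z\<in>Z. tensor_form R K (G z) (G z))"
    by (metis mult_le_cancel_left_pos mult_zero_right)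
  then show "0 \<le> (\<Sum>z\<in>Z. tensor_form R K (\<lambda>\<rho>. u (z + \<rho>) - u z) (\<lambda>\<rho>. u (z + \<rho>) - u z))"
    by (simp add: G_def[abs_def])
qed

text \<open>Testing with the real and imaginary parts of a plane wave cut off outside a large box: the two
  energies add up to the symbol at \<open>k\<close> times the volume, up to a boundary term of lower order.\<close>

lemma lattice_stable_imp_symb_nonneg:
  fixes R :: "(real ^ 'n::finite) set"
  assumes fin: "finite R" and R: "R \<subseteq> int_lattice" and stab: "lattice_stable R K"
  shows "symb_nonneg R K k"
  unfolding symb_nonneg_def
proof
  fix w :: "complex ^ 'n"
  define q where "q = cform R K (\<lambda>\<rho>. symb k \<rho> *s w) (\<lambda>\<rho>. symb k \<rho> *s w)"
  obtain b where b: "\<And>\<rho>. \<rho> \<in> R \<Longrightarrow> norm \<rho> \<le> b"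
    using finite_imp_bounded[OF fin] by (auto simp: bounded_iff)
  define M where "M = nat \<lceil>b\<rceil>"
  have M: "\<bar>\<rho> $ i\<bar> \<le> real M" if "\<rho> \<in> R" for \<rho> i
    using component_le_norm_cart[of \<rho> i] b[OF that] unfolding M_def by linarith
  \<comment> \<open>Differences of a wave of amplitude at most |w| are bounded by 2 |w|, so C bounds
    the energy at any single point, in particular across the cut.\<close>
  define C where "C = tensor_abs R K * (2 * norm w)\<^sup>2"
  have bound: "0 \<le> real n ^ CARD('n) * q + C * (real (n + 4 * M) ^ CARD('n) - real n ^ CARD('n))" for n
  proof -
    \<comment> \<open>The wave is cut off outside \<open>Q\<close>. A stencil reaches at most M in
      each coordinate: from \<open>I\<close> it stays in \<open>Q\<close> and sees the uncut wave,
      and from outside \<open>Z\<close> it sees only zeros. Two layers of width M on both sides give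
      side length n + 4 M.\<close>
    define I where "I = (int_box 0 (int n) :: (real ^ 'n) set)"
    define Q where "Q = (int_box (- int M) (int n + int M) :: (real ^ 'n) set)"
    define Z where "Z = (int_box (- 2 * int M) (int n + 2 * int M) :: (real ^ 'n) set)"
    define U where "U z = (if z \<in> Q then cis (z \<bullet> k) *s w else 0)" for z
    define D where "D z \<rho> = U (z + \<rho>) - U z" for z \<rho>
    have IQ: "z + \<rho> \<in> Q" if "z \<in> I" "\<rho> \<in> insert 0 R" for z \<rho>
    proof -
      have "\<bar>\<rho> $ i\<bar> \<le> real M" for i using that(2) M by auto
      moreover have "\<rho> \<in> int_lattice" using that(2) R by (auto simp: int_lattice_def)
      ultimately show ?thesis
        using that(1) by (auto simp: I_def Q_def int_box_iff abs_le_iff int_lattice_add) (smt (verit))+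
    qed
    have QZ: "z \<in> Z" if "z + \<rho> \<in> Q" "\<rho> \<in> insert 0 R" "z \<in> int_lattice" for z \<rho>
    proof -
      have "\<bar>\<rho> $ i\<bar> \<le> real M" for i using that(2) M by auto
      then show ?thesis
        using that(1,3) by (auto simp: Q_def Z_def int_box_iff abs_le_iff) (smt (verit))+
    qed
    have nonneg: "0 \<le> (\<Sum>z\<in>Z. tensor_form R K (\<lambda>\<rho>. u (z + \<rho>) - u z) (\<lambda>\<rho>. u (z + \<rho>) - u z))"
      if "\<And>z. z \<notin> Q \<Longrightarrow> u z = 0" for u
    proof -
      have "finite Z" "Z \<subseteq> int_lattice" by (auto simp: Z_def int_box_iff)
      with stab[unfolded lattice_stable_def] QZ that show ?thesis by blast
    qed
    have "0 \<le> (\<Sum>z\<in>Z. cform R K (D z) (D z))"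
      using nonneg[of "\<lambda>z. \<chi> j. Re (U z $ j)"] nonneg[of "\<lambda>z. \<chi> j. Im (U z $ j)"]
      by (simp add: cform_eq_tensor_form sum.distrib D_def U_def zero_vec_def minus_vec_def cong: if_cong)
    also have "\<dots> = (\<Sum>z\<in>I. cform R K (D z) (D z)) + (\<Sum>z\<in>Z - I. cform R K (D z) (D z))"
    proof -
      have "I \<subseteq> Z" by (auto simp: I_def Z_def int_box_iff) (smt (verit) of_nat_0_le_iff)+
      then show ?thesis by (simp add: sum.subset_diff Z_def add.commute)
    qed
    also have "(\<Sum>z\<in>I. cform R K (D z) (D z)) = (\<Sum>z\<in>I. q)"
    proof (rule sum.cong[OF refl])
      fix z assume z: "z \<in> I"
      have "D z \<rho> = cis (z \<bullet> k) *s (symb k \<rho> *s w)" if "\<rho> \<in> R" for \<rho>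
        using IQ[OF z, of \<rho>] IQ[OF z, of 0] that
        by (simp add: D_def U_def symb_def inner_add_left vec_eq_iff algebra_simps flip: cis_mult)
      then have "cform R K (D z) (D z)
          = cform R K (\<lambda>\<rho>. cis (z \<bullet> k) *s (symb k \<rho> *s w)) (\<lambda>\<rho>. cis (z \<bullet> k) *s (symb k \<rho> *s w))"
        by (simp add: cform_def)
      then show "cform R K (D z) (D z) = q" by (simp only: cform_cis q_def)
    qed
    also have "\<dots> = real n ^ CARD('n) * q" by (simp add: I_def card_int_box)
    also have "(\<Sum>z\<in>Z - I. cform R K (D z) (D z)) \<le> (\<Sum>z\<in>Z - I. C)"
    proof (rule sum_mono)
      fix z
      have U: "norm (U x) \<le> norm w" for x by (simp add: U_def norm_vector_smult)
      have D: "norm (D z \<rho> $ j) \<le> 2 * norm w" for \<rho> j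
        using Finite_Cartesian_Product.norm_nth_le[of "D z \<rho>" j] norm_triangle_ineq4[of "U (z + \<rho>)" "U z"] U[of z] U[of "z + \<rho>"]
        by (simp add: D_def)
      have "\<bar>D z \<rho> $ j \<bullet> D z \<sigma> $ l - 0 \<bullet> 0\<bar> \<le> (2 * norm w)\<^sup>2" for \<rho> \<sigma> j l
        using Cauchy_Schwarz_ineq2[of "D z \<rho> $ j" "D z \<sigma> $ l"]
          mult_mono[OF D[of \<rho> j] D[of \<sigma> l]] by (simp add: power2_eq_square)
      then have "\<bar>cform R K (D z) (D z) - cform R K (\<lambda>\<rho>. 0) (\<lambda>\<rho>. 0)\<bar> \<le> C"
        unfolding C_def by (intro cform_diff_bound) simp
      then show "cform R K (D z) (D z) \<le> C" by (simp add: cform_zero)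
    qed
    also have "\<dots> = C * (real (n + 4 * M) ^ CARD('n) - real n ^ CARD('n))"
    proof -
      have "I \<subseteq> Z" by (auto simp: I_def Z_def int_box_iff) (smt (verit) of_nat_0_le_iff)+
      then have "card (Z - I) = card Z - card I" "card I \<le> card Z"
        by (auto simp: card_Diff_subset I_def Z_def intro: card_mono)
      moreover have "card Z = (n + 4 * M) ^ CARD('n)" "card I = n ^ CARD('n)"
      proof -
        have "nat (int n + 2 * int M - - 2 * int M) = n + 4 * M" by linarith
        then show "card Z = (n + 4 * M) ^ CARD('n)" by (simp only: Z_def card_int_box)
      qed (simp add: I_def card_int_box)
      ultimately show ?thesis by (simp add: of_nat_diff)
    qed
    finally show ?thesis by simp
  qed
  have "0 \<le> q + C * ((1 + real (4 * M) / real n) ^ CARD('n) - 1)" if "n > 0" for n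
  proof -
    have "0 \<le> (real n ^ CARD('n) * q + C * (real (n + 4 * M) ^ CARD('n) - real n ^ CARD('n))) / real n ^ CARD('n)"
      by (intro divide_nonneg_nonneg bound) simp
    also have "\<dots> = q + C * ((real (n + 4 * M) / real n) ^ CARD('n) - 1)"
      using that by (simp add: field_simps)
    also have "real (n + 4 * M) / real n = 1 + real (4 * M) / real n"
      using that by (simp add: field_simps)
    finally show ?thesis .
  qed
  \<comment> \<open>After division by the number n^d of interior points, the share of the layer is
    (1 + 4 M / n)^d - 1, which tends to 0 and leaves q alone.\<close>
  moreover have "(\<lambda>n. q + C * ((1 + real (4 * M) / real n) ^ CARD('n) - 1)) \<longlonglongrightarrow> q + C * ((1 + 0) ^ CARD('n) - 1)"
    by (intro tendsto_intros lim_const_over_n)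
  ultimately have "0 \<le> q + C * ((1 + 0) ^ CARD('n) - 1)"
    by (intro tendsto_lowerbound[where F = sequentially]) (auto intro: eventually_sequentiallyI[of 1])
  then show "0 \<le> cform R K (\<lambda>\<rho>. symb k \<rho> *s w) (\<lambda>\<rho>. symb k \<rho> *s w)" by (simp add: q_def)
qed

section \<open>Auxiliary facts on the form, the lattice and the interaction range\<close>

lemma tensor_form_cong:
  "(\<And>\<rho>. \<rho> \<in> R \<Longrightarrow> A \<rho> = A' \<rho>) \<Longrightarrow> (\<And>\<rho>. \<rho> \<in> R \<Longrightarrow> B \<rho> = B' \<rho>) \<Longrightarrow>
    tensor_form R K A B = tensor_form R K A' B'"
  by (simp add: tensor_form_def)

lemma tensor_form_scaleR:
  "tensor_form R K (\<lambda>\<rho>. s *\<^sub>R A \<rho>) (\<lambda>\<rho>. s *\<^sub>R A \<rho>) = s\<^sup>2 * tensor_form R K A A"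
  by (simp add: tensor_form_def sum_distrib_left power2_eq_square mult_ac)

lemma tensor_form_zero: "tensor_form R K (\<lambda>\<rho>. 0) (\<lambda>\<rho>. 0) = 0"
  by (simp add: tensor_form_def)

lemma finite_int_lattice_bounded:
  assumes "bounded (S :: (real ^ 'n::finite) set)" "S \<subseteq> int_lattice"
  shows "finite S"
proof -
  obtain b where b: "\<And>z. z \<in> S \<Longrightarrow> norm z \<le> b"
    using assms(1) by (auto simp: bounded_iff)
  define m where "m = \<lceil>b\<rceil> + 1"
  have "S \<subseteq> int_box (- m) m"
  proof
    fix z assume z: "z \<in> S"
    have "- real_of_int m \<le> z $ i \<and> z $ i < real_of_int m" for i
      using component_le_norm_cart[of z i] b[OF z] unfolding m_def by linarith
    then show "z \<in> int_box (- m) m" using z assms(2) by (auto simp: int_box_iff)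
  qed
  then show ?thesis by (rule finite_subset) simp
qed

text \<open>A segment that leaves S crosses the frontier, and the crossing point is no farther from
  p than q is.\<close>

lemma mem_if_dist_less_infdist_frontier:
  fixes p q :: "'a::real_normed_vector"
  assumes "p \<in> S" "dist p q < infdist p (frontier S)"
  shows "q \<in> S"
proof (rule ccontr)
  assume "q \<notin> S"
  then have "closed_segment p q \<inter> frontier S \<noteq> {}"
    using assms(1) by (intro connected_Int_frontier) auto
  then obtain r where "r \<in> closed_segment p q" "r \<in> frontier S" by auto
  then have "infdist p (frontier S) \<le> dist p q"
    using infdist_le[of r "frontier S" p] segment_bound(1)[of r p q]
    by (simp add: dist_norm norm_minus_commute)
  with assms(2) show False by simp
qed

lemma interaction_rangeD:
  assumes "interaction_range R"
  shows "finite R" "R \<subseteq> int_lattice" "0 \<notin> R" "int_span R = int_lattice"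
  using assms by (auto simp: interaction_range_def)

text \<open>The form in which generation of the lattice by R is used: coordinates of k are integer
  combinations of the phases \<rho> \<bullet> k, so vanishing of all phases, exactly or modulo 2
  \<pi>, passes to the coordinates.\<close>

lemma axis_int_combination:
  fixes R :: "(real ^ 'n::finite) set"
  assumes R: "interaction_range R"
  obtains c :: "real ^ 'n \<Rightarrow> int" where "\<And>k. k $ i = (\<Sum>\<rho>\<in>R. of_int (c \<rho>) * (\<rho> \<bullet> k))"
proof -
  have "axis i 1 \<in> int_span R"
    unfolding interaction_rangeD(4)[OF R] int_lattice_def axis_def by simp
  then obtain c :: "real ^ 'n \<Rightarrow> int" where c: "axis i 1 = (\<Sum>\<rho>\<in>R. of_int (c \<rho>) *\<^sub>R \<rho>)"
    unfolding int_span_finite[OF interaction_rangeD(1)[OF R]] by auto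
  have "k $ i = (\<Sum>\<rho>\<in>R. of_int (c \<rho>) * (\<rho> \<bullet> k))" for k
  proof -
    have "k $ i = axis i 1 \<bullet> k" by (simp add: inner_axis' )
    then show ?thesis by (simp add: c inner_sum_left)
  qed
  then show ?thesis by (rule that)
qed

lemma interaction_range_nonempty:
  fixes R :: "(real ^ 'n::finite) set"
  assumes "interaction_range R"
  shows "R \<noteq> {}"
proof
  assume "R = {}"
  obtain c :: "real ^ 'n \<Rightarrow> int" where "\<And>k :: real ^ 'n. k $ undefined = (\<Sum>\<rho>\<in>R. of_int (c \<rho>) * (\<rho> \<bullet> k))"
    using axis_int_combination[OF assms] by blast
  from this[of "axis undefined 1"] \<open>R = {}\<close> show False by simp
qed

lemma ex_inner_nonzero:
  assumes R: "interaction_range R" and "k \<noteq> 0"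
  shows "\<exists>\<rho>\<in>R. \<rho> \<bullet> k \<noteq> 0"
proof (rule ccontr)
  assume *: "\<not> (\<exists>\<rho>\<in>R. \<rho> \<bullet> k \<noteq> 0)"
  have "k $ i = 0" for i
  proof -
    obtain c where "\<And>k. k $ i = (\<Sum>\<rho>\<in>R. of_int (c \<rho>) * (\<rho> \<bullet> k))"
      using axis_int_combination[OF R] by blast
    with * show ?thesis by simp
  qed
  with \<open>k \<noteq> 0\<close> show False by (simp add: vec_eq_iff)
qed

text \<open>If all symbols vanish, the phases are integer multiples of 2 \<pi>, hence so are the
  coordinates of k, and the bound makes them 0. The symmetric bound serves both the cube of the
  first formula and the small cubes of the limit.\<close>

lemma ex_symb_nonzero:
  assumes R: "interaction_range R" and "k \<noteq> 0" and small: "\<And>i. \<bar>k $ i\<bar> < 2 * pi"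
  shows "\<exists>\<rho>\<in>R. symb k \<rho> \<noteq> 0"
proof (rule ccontr)
  assume "\<not> (\<exists>\<rho>\<in>R. symb k \<rho> \<noteq> 0)"
  then have "\<forall>\<rho>\<in>R. \<exists>n::int. \<rho> \<bullet> k = 2 * pi * n" by (auto simp: symb_def intro: cis_eq_1D)
  then obtain n :: "_ \<Rightarrow> int" where n: "\<And>\<rho>. \<rho> \<in> R \<Longrightarrow> \<rho> \<bullet> k = 2 * pi * n \<rho>" by metis
  have "k $ i = 0" for i
  proof -
    obtain c where c: "\<And>k. k $ i = (\<Sum>\<rho>\<in>R. of_int (c \<rho>) * (\<rho> \<bullet> k))"
      using axis_int_combination[OF R] by blast
    define m where "m = (\<Sum>\<rho>\<in>R. c \<rho> * n \<rho>)"
    have "k $ i = 2 * pi * real_of_int m"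
      unfolding c m_def by (simp add: n sum_distrib_left mult_ac)
    with small[of i] have "\<bar>real_of_int m\<bar> < 1" by (simp add: abs_mult)
    then have "m = 0" by linarith
    with \<open>k $ i = 2 * pi * real_of_int m\<close> show ?thesis by simp
  qed
  with \<open>k \<noteq> 0\<close> show False by (simp add: vec_eq_iff)
qed

lemma range_radius_ge:
  assumes "finite R" "\<rho> \<in> R"
  shows "norm \<rho> \<le> range_radius R"
  using assms by (simp add: range_radius_def le_max_iff_disj)

lemma range_radius_pos: "range_radius (R :: (real ^ 'n::finite) set) > 0"
proof -
  have "sqrt (real CARD('n)) / 4 > 0" by simp
  then show ?thesis unfolding range_radius_def by linarith
qed

section \<open>Rescaling of the atomistic energy\<close>

text \<open>The substitution x = \<epsilon> z passes to the unit lattice. \<open>u\<close> is the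
  extension of the deformation by zero, and \<open>Z\<close> is the rescaled semi-interior.\<close>

context
  fixes R \<Omega> :: "(real ^ 'n::finite) set" and \<epsilon> :: real and y :: "real ^ 'n \<Rightarrow> real ^ 'n"
    and u :: "real ^ 'n \<Rightarrow> real ^ 'n" and Z :: "(real ^ 'n) set"
  assumes R: "interaction_range R" and \<Omega>: "bounded \<Omega>" and \<epsilon>: "\<epsilon> > 0" and y: "y \<in> admissible R \<Omega> \<epsilon>"
  defines "u \<equiv> \<lambda>z. if \<epsilon> *\<^sub>R z \<in> \<Omega> then y (\<epsilon> *\<^sub>R z) else 0"
    and "Z \<equiv> {z \<in> int_lattice. \<epsilon> *\<^sub>R z \<in> semi_interior R \<Omega> \<epsilon>}"
begin

lemma semi_interior_eq_image: "semi_interior R \<Omega> \<epsilon> = (\<lambda>z. \<epsilon> *\<^sub>R z) ` Z"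
  by (auto simp: Z_def semi_interior_def lattice_points_def)

lemma finite_rescaled: "finite Z"
proof -
  have "bounded ((\<lambda>x. (1 / \<epsilon>) *\<^sub>R x) ` \<Omega>)" using \<Omega> by (rule bounded_scaling)
  moreover have "Z \<subseteq> (\<lambda>x. (1 / \<epsilon>) *\<^sub>R x) ` \<Omega>"
  proof
    fix z assume "z \<in> Z"
    then have "\<epsilon> *\<^sub>R z \<in> \<Omega>" by (simp add: Z_def semi_interior_def lattice_points_def)
    moreover have "z = (1 / \<epsilon>) *\<^sub>R (\<epsilon> *\<^sub>R z)" using \<epsilon> by simp
    ultimately show "z \<in> (\<lambda>x. (1 / \<epsilon>) *\<^sub>R x) ` \<Omega>" by blast
  qed
  ultimately have "bounded Z" by (rule bounded_subset)
  then show ?thesis by (rule finite_int_lattice_bounded) (auto simp: Z_def)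
qed

text \<open>Here the factor 2 in the boundary condition matters: a point with nonzero value is
  farther than 2 \<epsilon> R_0 from the frontier, a stencil step has length at most \<epsilon> R_0,
  so the base point keeps a distance above \<epsilon> R_0.\<close>

lemma rescaled_support:
  assumes z: "z \<in> int_lattice" and \<rho>: "\<rho> \<in> insert 0 R" and nz: "u (z + \<rho>) \<noteq> 0"
  shows "z \<in> Z"
proof -
  define p q where "p = \<epsilon> *\<^sub>R (z + \<rho>)" and "q = \<epsilon> *\<^sub>R z"
  define r where "r = \<epsilon> * range_radius R"
  have r: "r > 0" using \<epsilon> range_radius_pos[of R] by (simp add: r_def)
  have pO: "p \<in> \<Omega>" and yp: "y p \<noteq> 0" using nz by (auto simp: u_def p_def split: if_splits)
  have "z + \<rho> \<in> int_lattice" using z \<rho> interaction_rangeD(2)[OF R]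
    by (auto intro: int_lattice_add)
  then have "p \<in> lattice_points \<Omega> \<epsilon>" using pO by (auto simp: lattice_points_def p_def)
  then have far: "infdist p (frontier \<Omega>) > 2 * r"
    using y yp unfolding admissible_def r_def by (auto simp: mult.assoc)
  have "norm \<rho> \<le> range_radius R"
    using \<rho> range_radius_ge[OF interaction_rangeD(1)[OF R]] range_radius_pos[of R] by force
  moreover have "dist p q = \<epsilon> * norm \<rho>" using \<epsilon> by (simp add: p_def q_def dist_norm algebra_simps)
  ultimately have pq: "dist p q \<le> r" using \<epsilon> by (simp add: r_def)
  have "q \<in> \<Omega>" using pq far r by (intro mem_if_dist_less_infdist_frontier[OF pO]) linarith
  moreover have "infdist q (frontier \<Omega>) > r"
    using infdist_triangle[of p "frontier \<Omega>" q] pq far r by linarith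
  ultimately show ?thesis
    using z by (auto simp: Z_def q_def semi_interior_def lattice_points_def r_def)
qed

text \<open>From a point of the semi-interior the whole stencil stays inside \<Omega>, so extending
  by zero changes none of the values entering the quotient.\<close>

lemma diff_quot_rescaled:
  assumes z: "z \<in> Z" and \<rho>: "\<rho> \<in> R"
  shows "diff_quot \<epsilon> y (\<epsilon> *\<^sub>R z) \<rho> = (1 / \<epsilon>) *\<^sub>R (u (z + \<rho>) - u z)"
proof -
  have zO: "\<epsilon> *\<^sub>R z \<in> \<Omega>" and far: "infdist (\<epsilon> *\<^sub>R z) (frontier \<Omega>) > \<epsilon> * range_radius R"
    using z by (auto simp: Z_def semi_interior_def lattice_points_def)
  have "dist (\<epsilon> *\<^sub>R z) (\<epsilon> *\<^sub>R (z + \<rho>)) = \<epsilon> * norm \<rho>"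
    using \<epsilon> by (simp add: dist_norm scaleR_add_right)
  also have "\<dots> \<le> \<epsilon> * range_radius R"
    using range_radius_ge[OF interaction_rangeD(1)[OF R] \<rho>] \<epsilon> by simp
  also note far
  finally have "\<epsilon> *\<^sub>R (z + \<rho>) \<in> \<Omega>" by (rule mem_if_dist_less_infdist_frontier[OF zO])
  then show ?thesis using zO by (simp add: diff_quot_def u_def scaleR_add_right inverse_eq_divide)
qed

lemma sum_semi_interior:
  "(\<Sum>x\<in>semi_interior R \<Omega> \<epsilon>. tensor_form R K (diff_quot \<epsilon> y x) (diff_quot \<epsilon> y x))
     = (1 / \<epsilon>)\<^sup>2 * (\<Sum>z\<in>Z. tensor_form R K (\<lambda>\<rho>. u (z + \<rho>) - u z) (\<lambda>\<rho>. u (z + \<rho>) - u z))"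
proof -
  have "(\<Sum>x\<in>semi_interior R \<Omega> \<epsilon>. tensor_form R K (diff_quot \<epsilon> y x) (diff_quot \<epsilon> y x))
      = (\<Sum>z\<in>Z. tensor_form R K (diff_quot \<epsilon> y (\<epsilon> *\<^sub>R z)) (diff_quot \<epsilon> y (\<epsilon> *\<^sub>R z)))"
    unfolding semi_interior_eq_image using \<epsilon> by (subst sum.reindex) (auto simp: inj_on_def)
  also have "\<dots> = (\<Sum>z\<in>Z. (1 / \<epsilon>)\<^sup>2 * tensor_form R K (\<lambda>\<rho>. u (z + \<rho>) - u z) (\<lambda>\<rho>. u (z + \<rho>) - u z))"
    unfolding tensor_form_scaleR[symmetric]
    by (rule sum.cong[OF refl], rule tensor_form_cong) (simp_all only: diff_quot_rescaled)
  finally show ?thesis by (simp add: sum_distrib_left)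
qed

text \<open>A deformation whose finite differences all vanish is invariant under translation by any
  \<open>\<rho> \<in> R\<close>, which is incompatible with a nonempty finite support.\<close>

lemma sum_diff_quot_pos:
  assumes nz: "x \<in> lattice_points \<Omega> \<epsilon>" "y x \<noteq> 0"
  shows "(\<Sum>x\<in>semi_interior R \<Omega> \<epsilon>. \<Sum>\<rho>\<in>R. (norm (diff_quot \<epsilon> y x \<rho>))\<^sup>2) > 0"
proof (rule ccontr)
  assume not: "\<not> ?thesis"
  have finR: "finite R" by (rule interaction_rangeD(1)[OF R])
  have finS: "finite (semi_interior R \<Omega> \<epsilon>)"
    unfolding semi_interior_eq_image using finite_rescaled by simp
  have "(\<Sum>x\<in>semi_interior R \<Omega> \<epsilon>. \<Sum>\<rho>\<in>R. (norm (diff_quot \<epsilon> y x \<rho>))\<^sup>2) = 0"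
    using not by (intro antisym sum_nonneg) auto
  then have "\<forall>x\<in>semi_interior R \<Omega> \<epsilon>. (\<Sum>\<rho>\<in>R. (norm (diff_quot \<epsilon> y x \<rho>))\<^sup>2) = 0"
    by (subst (asm) sum_nonneg_eq_0_iff[OF finS]) (auto intro: sum_nonneg)
  then have zero: "diff_quot \<epsilon> y x \<rho> = 0" if "x \<in> semi_interior R \<Omega> \<epsilon>" "\<rho> \<in> R" for x \<rho>
    using that by (simp add: sum_nonneg_eq_0_iff[OF finR])
  \<comment> \<open>On \<open>Z\<close> invariance is the vanishing of the quotient; at the other
    lattice points both values are 0 by \<open>rescaled_support\<close>.\<close>
  have step: "u (z + \<rho>) = u z" if z: "z \<in> int_lattice" and \<rho>: "\<rho> \<in> R" for z \<rho>
  proof (cases "z \<in> Z")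
    case True
    then have "\<epsilon> *\<^sub>R z \<in> semi_interior R \<Omega> \<epsilon>" by (simp add: Z_def)
    with zero[OF this \<rho>] diff_quot_rescaled[OF True \<rho>] \<epsilon> show ?thesis by simp
  next
    case False
    then have "u (z + 0) = 0" "u (z + \<rho>) = 0" using rescaled_support[OF z] \<rho> by blast+
    then show ?thesis by simp
  qed
  obtain \<rho> where \<rho>: "\<rho> \<in> R" using interaction_range_nonempty[OF R] by blast
  have \<rho>0: "\<rho> \<noteq> 0" using \<rho> interaction_rangeD(3)[OF R] by blast
  obtain z where z: "z \<in> int_lattice" "u z \<noteq> 0"
    using nz by (auto simp: lattice_points_def u_def)
  have iter: "z + real n *\<^sub>R \<rho> \<in> int_lattice \<and> u (z + real n *\<^sub>R \<rho>) = u z" for n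
  proof (induction n)
    case (Suc n)
    have eq: "z + real (Suc n) *\<^sub>R \<rho> = (z + real n *\<^sub>R \<rho>) + \<rho>" by (simp add: algebra_simps)
    have "\<rho> \<in> int_lattice" using \<rho> interaction_rangeD(2)[OF R] by blast
    with Suc step[OF _ \<rho>] show ?case unfolding eq by (simp add: int_lattice_add)
  qed (use z in simp)
  have "range (\<lambda>n. z + real n *\<^sub>R \<rho>) \<subseteq> Z"
  proof (rule image_subsetI)
    fix n
    show "z + real n *\<^sub>R \<rho> \<in> Z"
      by (rule rescaled_support[of _ 0]) (simp_all add: iter z)
  qed
  then have "finite (range (\<lambda>n. z + real n *\<^sub>R \<rho>))" using finite_rescaled by (rule finite_subset)
  moreover have "inj (\<lambda>n. z + real n *\<^sub>R \<rho>)" using \<rho>0 by (auto simp: inj_on_def)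
  ultimately show False using range_inj_infinite by blast
qed

end

section \<open>Fitting finitely supported lattice functions into the domain\<close>

lemma floor_vec_approx:
  fixes p :: "real ^ 'n::finite"
  assumes "\<epsilon> > 0"
  obtains v where "v \<in> int_lattice" "norm (\<epsilon> *\<^sub>R v - p) \<le> \<epsilon> * CARD('n)"
proof
  define v :: "real ^ 'n" where "v = (\<chi> i. real_of_int \<lfloor>p $ i / \<epsilon>\<rfloor>)"
  show "v \<in> int_lattice" by (simp add: v_def int_lattice_def)
  have "norm (\<epsilon> *\<^sub>R v - p) \<le> (\<Sum>i\<in>UNIV. \<bar>(\<epsilon> *\<^sub>R v - p) $ i\<bar>)" by (rule norm_le_l1_cart)
  also have "\<dots> \<le> (\<Sum>i\<in>(UNIV::'n set). \<epsilon>)"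
  proof (rule sum_mono)
    fix i
    have "(\<epsilon> *\<^sub>R v - p) $ i = \<epsilon> * (of_int \<lfloor>p $ i / \<epsilon>\<rfloor> - p $ i / \<epsilon>)"
      using assms by (simp add: v_def algebra_simps)
    also have "\<bar>\<dots>\<bar> \<le> \<epsilon> * 1"
      unfolding abs_mult using assms by (intro mult_mono) linarith+
    finally show "\<bar>(\<epsilon> *\<^sub>R v - p) $ i\<bar> \<le> \<epsilon>" by simp
  qed
  finally show "norm (\<epsilon> *\<^sub>R v - p) \<le> \<epsilon> * CARD('n)" by (simp add: mult.commute)
qed

text \<open>Frontier points lie outside the open set, hence outside the ball, and the triangle
  inequality applies. As \<open>infdist\<close> to the empty set is 0, the frontier must first be
  shown nonempty, which holds because \<Omega> is bounded and nonempty.\<close>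

lemma infdist_frontier_ge:
  fixes p :: "'a::{real_normed_vector, perfect_space}"
  assumes ball: "ball p r \<subseteq> \<Omega>" and \<Omega>: "open \<Omega>" "bounded \<Omega>" "\<Omega> \<noteq> {}"
  shows "r - dist x p \<le> infdist x (frontier \<Omega>)"
proof -
  have "\<Omega> \<noteq> UNIV" using \<Omega>(2) not_bounded_UNIV by metis
  then have ne: "frontier \<Omega> \<noteq> {}" by (rule frontier_not_empty[OF \<Omega>(3)])
  have "r - dist x p \<le> dist x f" if "f \<in> frontier \<Omega>" for f
  proof -
    have "f \<notin> \<Omega>" using that \<Omega>(1) by (simp add: frontier_def interior_open)
    then have "f \<notin> ball p r" using ball by blast
    then have "dist p f \<ge> r" by simp
    then show ?thesis using dist_triangle[of p f x] by (simp add: dist_commute)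
  qed
  then show ?thesis unfolding infdist_notempty[OF ne] by (rule cINF_greatest[OF ne])
qed

text \<open>Clearing the positive denominator and rescaling leaves an instance of lattice stability,
  the factor 1 / \<epsilon>^2 having no influence on the sign. Since \<Omega> is absent from the
  right-hand side, the independence of the domain is part of the result.\<close>

lemma le_lambda_atom_iff:
  fixes R \<Omega> :: "(real ^ 'n::finite) set"
  assumes R: "interaction_range R" and \<Omega>: "open \<Omega>" "bounded \<Omega>" "\<Omega> \<noteq> {}"
  shows "ereal c \<le> lambda_atom R \<Omega> K \<longleftrightarrow> lattice_stable R (shift_tensor K c)"
proof -
  define num where "num \<epsilon> y = (\<Sum>x\<in>semi_interior R \<Omega> \<epsilon>. tensor_form R K (diff_quot \<epsilon> y x) (diff_quot \<epsilon> y x))" for \<epsilon> y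
  define den where "den \<epsilon> y = (\<Sum>x\<in>semi_interior R \<Omega> \<epsilon>. \<Sum>\<rho>\<in>R. (norm (diff_quot \<epsilon> y x \<rho>))\<^sup>2)" for \<epsilon> y
  define u where "u \<epsilon> y z = (if \<epsilon> *\<^sub>R z \<in> \<Omega> then y (\<epsilon> *\<^sub>R z) else (0 :: real ^ 'n))" for \<epsilon> y z
  define Z where "Z \<epsilon> = {z \<in> int_lattice. \<epsilon> *\<^sub>R z \<in> semi_interior R \<Omega> \<epsilon>}" for \<epsilon>
  define S where "S u Z = (\<Sum>z\<in>Z. tensor_form R (shift_tensor K c) (\<lambda>\<rho>. u (z + \<rho>) - u z) (\<lambda>\<rho>. u (z + \<rho>) - u z))"
    for u :: "real ^ 'n \<Rightarrow> real ^ 'n" and Z :: "(real ^ 'n) set"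
  note finR = interaction_rangeD(1)[OF R]
  have quot: "c \<le> num \<epsilon> y / den \<epsilon> y \<longleftrightarrow> 0 \<le> S (u \<epsilon> y) (Z \<epsilon>)"
    if "\<epsilon> > 0" "y \<in> admissible R \<Omega> \<epsilon>" "\<exists>x\<in>lattice_points \<Omega> \<epsilon>. y x \<noteq> 0" for \<epsilon> y
  proof -
    have "den \<epsilon> y > 0"
      using sum_diff_quot_pos[OF R \<Omega>(2) that(1,2)] that(3) by (auto simp: den_def)
    then have "c \<le> num \<epsilon> y / den \<epsilon> y \<longleftrightarrow> 0 \<le> num \<epsilon> y - c * den \<epsilon> y"
      by (simp add: pos_le_divide_eq)
    also have "num \<epsilon> y - c * den \<epsilon> y = (\<Sum>x\<in>semi_interior R \<Omega> \<epsilon>.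
        tensor_form R (shift_tensor K c) (diff_quot \<epsilon> y x) (diff_quot \<epsilon> y x))"
      by (simp add: num_def den_def tensor_form_shift[OF finR] sum_subtractf sum_distrib_left)
    also have "\<dots> = (1 / \<epsilon>)\<^sup>2 * S (u \<epsilon> y) (Z \<epsilon>)"
      using sum_semi_interior[OF R \<Omega>(2) that(1,2)] by (simp add: S_def u_def Z_def)
    finally show ?thesis using that(1) by (simp add: zero_le_mult_iff zero_le_divide_iff)
  qed
  have atom: "ereal c \<le> lambda_atom R \<Omega> K \<longleftrightarrow>
      (\<forall>\<epsilon> y. \<epsilon> > 0 \<and> y \<in> admissible R \<Omega> \<epsilon> \<and> (\<exists>x\<in>lattice_points \<Omega> \<epsilon>. y x \<noteq> 0) \<longrightarrow> 0 \<le> S (u \<epsilon> y) (Z \<epsilon>))"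
  proof -
    have "ereal c \<le> lambda_atom R \<Omega> K \<longleftrightarrow>
        (\<forall>\<epsilon>\<in>{0<..}. \<forall>y\<in>{y \<in> admissible R \<Omega> \<epsilon>. \<exists>x\<in>lattice_points \<Omega> \<epsilon>. y x \<noteq> 0}. c \<le> num \<epsilon> y / den \<epsilon> y)"
      unfolding lambda_atom_def num_def[symmetric] den_def[symmetric] le_INF_iff ereal_less_eq(3) ..
    also have "\<dots> \<longleftrightarrow>
        (\<forall>\<epsilon>\<in>{0<..}. \<forall>y\<in>{y \<in> admissible R \<Omega> \<epsilon>. \<exists>x\<in>lattice_points \<Omega> \<epsilon>. y x \<noteq> 0}. 0 \<le> S (u \<epsilon> y) (Z \<epsilon>))"
      by (intro ball_cong refl quot) (simp_all only: greaterThan_iff mem_Collect_eq)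
    finally show ?thesis by blast
  qed
  show ?thesis
  proof
    assume stab: "lattice_stable R (shift_tensor K c)"
    show "ereal c \<le> lambda_atom R \<Omega> K"
      unfolding atom
    proof (intro allI impI, elim conjE)
      fix \<epsilon> :: real and y assume *: "\<epsilon> > 0" "y \<in> admissible R \<Omega> \<epsilon>"
      have "finite (Z \<epsilon>)" using finite_rescaled[OF R \<Omega>(2) *] by (simp add: Z_def)
      moreover have "\<forall>z\<in>int_lattice. \<forall>\<rho>\<in>insert 0 R. u \<epsilon> y (z + \<rho>) \<noteq> 0 \<longrightarrow> z \<in> Z \<epsilon>"
        using rescaled_support[OF R \<Omega>(2) *] unfolding Z_def u_def by blast
      ultimately show "0 \<le> S (u \<epsilon> y) (Z \<epsilon>)"
        using stab unfolding lattice_stable_def S_def by (auto simp: Z_def)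
    qed
  next
    assume "ereal c \<le> lambda_atom R \<Omega> K"
    note atom = this[unfolded atom, rule_format]
    show "lattice_stable R (shift_tensor K c)"
      unfolding lattice_stable_def S_def[symmetric]
    proof (intro allI impI, elim conjE)
      fix f :: "real ^ 'n \<Rightarrow> real ^ 'n" and W :: "(real ^ 'n) set"
      assume W: "finite W" "W \<subseteq> int_lattice"
        and supp: "\<forall>z\<in>int_lattice. \<forall>\<rho>\<in>insert 0 R. f (z + \<rho>) \<noteq> 0 \<longrightarrow> z \<in> W"
      show "0 \<le> S f W"
      proof (cases "\<exists>z\<in>int_lattice. f z \<noteq> 0")
        \<comment> \<open>Such an f yields no nonzero deformation to test with, but all its
          differences on the lattice vanish.\<close>
        case False
        then have "f (z + \<rho>) - f z = 0" if "z \<in> W" "\<rho> \<in> R" for z \<rho>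
        proof -
          have "z \<in> int_lattice" "z + \<rho> \<in> int_lattice"
            using that W interaction_rangeD(2)[OF R] by (auto intro: int_lattice_add)
          with False show ?thesis by simp
        qed
        then have "S f W = 0"
          unfolding S_def by (intro sum.neutral ballI) (subst tensor_form_cong[where A' = "\<lambda>_. 0" and B' = "\<lambda>_. 0"], auto simp: tensor_form_zero)
        then show ?thesis by simp
      next
        case True
        then obtain z0 where z0: "z0 \<in> int_lattice" "f z0 \<noteq> 0" by blast
        obtain b where b: "b > 0" "\<And>z. z \<in> W \<Longrightarrow> norm z \<le> b"
          using finite_imp_bounded[OF W(1)] by (auto simp: bounded_pos)
        obtain p r where r: "r > 0" "ball p r \<subseteq> \<Omega>"
          using \<Omega> by (meson all_not_in_conv open_contains_ball)
        define r0 where "r0 = range_radius R"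
        have r0: "r0 > 0" by (simp add: r0_def range_radius_pos)
        \<comment> \<open>A budget in units of \<epsilon>: rounding the centre p to the scaled
          lattice costs at most d, the support of f at most b, the collar of zero values 2 R_0. Half
          of r covers the sum, so f translated by v and scaled by \<epsilon> fits strictly into the
          ball.\<close>
        define s where "s = real CARD('n) + b + 2 * r0"
        have s: "s > 0" using b r0 by (simp add: s_def)
        define \<epsilon> where "\<epsilon> = r / (2 * s)"
        have \<epsilon>: "\<epsilon> > 0" "\<epsilon> * s < r" using r s by (simp_all add: \<epsilon>_def)
        obtain v where v: "v \<in> int_lattice" "norm (\<epsilon> *\<^sub>R v - p) \<le> \<epsilon> * CARD('n)"
          using floor_vec_approx[OF \<epsilon>(1)] by blast
        have near: "\<epsilon> *\<^sub>R (z + v) \<in> \<Omega>" "infdist (\<epsilon> *\<^sub>R (z + v)) (frontier \<Omega>) > 2 * \<epsilon> * r0"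
          if z: "z \<in> W" for z
        proof -
          have "dist (\<epsilon> *\<^sub>R (z + v)) p = norm (\<epsilon> *\<^sub>R z + (\<epsilon> *\<^sub>R v - p))"
            by (simp add: dist_norm algebra_simps)
          also have "\<dots> \<le> \<epsilon> * b + \<epsilon> * CARD('n)"
            using b(2)[OF z] \<epsilon>(1) v(2) by (intro norm_triangle_mono) auto
          finally have d: "dist (\<epsilon> *\<^sub>R (z + v)) p < r - 2 * \<epsilon> * r0"
            using \<epsilon>(2) by (simp add: s_def algebra_simps)
          have "2 * \<epsilon> * r0 > 0" using \<epsilon>(1) r0 by simp
          then have "dist (\<epsilon> *\<^sub>R (z + v)) p < r" using d by linarith
          then show "\<epsilon> *\<^sub>R (z + v) \<in> \<Omega>" using r(2) by (auto simp: dist_commute)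
          show "infdist (\<epsilon> *\<^sub>R (z + v)) (frontier \<Omega>) > 2 * \<epsilon> * r0"
            using infdist_frontier_ge[OF r(2) \<Omega>, of "\<epsilon> *\<^sub>R (z + v)"] d by linarith
        qed
        have inW: "z \<in> W" if "z \<in> int_lattice" "f z \<noteq> 0" for z
          using supp that by force
        define y where "y x = f ((1 / \<epsilon>) *\<^sub>R x - v)" for x
        have y_scale: "y (\<epsilon> *\<^sub>R z) = f (z - v)" for z using \<epsilon>(1) by (simp add: y_def)
        have "y \<in> admissible R \<Omega> \<epsilon>"
          unfolding admissible_def
        proof (intro CollectI ballI impI, rule ccontr)
          fix x assume x: "x \<in> lattice_points \<Omega> \<epsilon>"
            and close: "infdist x (frontier \<Omega>) \<le> 2 * \<epsilon> * range_radius R" and nz: "y x \<noteq> 0"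
          then obtain z where z: "x = \<epsilon> *\<^sub>R z" "z \<in> int_lattice" by (auto simp: lattice_points_def)
          then have "z - v \<in> W" using inW[of "z - v"] nz v(1) by (auto simp: y_scale int_lattice_diff)
          from near(2)[OF this] close show False by (simp add: z r0_def)
        qed
        moreover have "\<exists>x\<in>lattice_points \<Omega> \<epsilon>. y x \<noteq> 0"
          using near(1)[OF inW[OF z0]] z0 v(1)
          by (intro bexI[of _ "\<epsilon> *\<^sub>R (z0 + v)"]) (auto simp: y_scale lattice_points_def int_lattice_add)
        ultimately have "0 \<le> S (u \<epsilon> y) (Z \<epsilon>)" using atom \<epsilon>(1) by blast
        \<comment> \<open>On the lattice the rescaled deformation is f translated by v, also outside
          \<Omega>, where f contributes only zeros. The rescaled semi-interior contains the
          translate of \<open>W\<close>, and its surplus points carry no energy.\<close>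
        also have "S (u \<epsilon> y) (Z \<epsilon>) = S f W"
        proof -
          have uf: "u \<epsilon> y z = f (z - v)" if "z \<in> int_lattice" for z
            using near(1)[OF inW[of "z - v"]] that v(1) by (auto simp: u_def y_scale int_lattice_diff)
          have sub: "(\<lambda>z. z + v) ` W \<subseteq> Z \<epsilon>"
          proof (rule image_subsetI)
            fix z assume z: "z \<in> W"
            have "\<epsilon> * r0 < 2 * \<epsilon> * r0" using \<epsilon>(1) r0 by simp
            with near[OF z] have "infdist (\<epsilon> *\<^sub>R (z + v)) (frontier \<Omega>) > \<epsilon> * r0" by linarith
            moreover have "z + v \<in> int_lattice" using z W v by (auto intro: int_lattice_add)
            ultimately show "z + v \<in> Z \<epsilon>" using near(1)[OF z]
              by (auto simp: Z_def semi_interior_def lattice_points_def r0_def)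
          qed
          have finZ: "finite (Z \<epsilon>)"
            using finite_rescaled[OF R \<Omega>(2) \<epsilon>(1) \<open>y \<in> admissible R \<Omega> \<epsilon>\<close>] by (simp add: Z_def)
          define g where "g z = tensor_form R (shift_tensor K c)
            (\<lambda>\<rho>. f (z - v + \<rho>) - f (z - v)) (\<lambda>\<rho>. f (z - v + \<rho>) - f (z - v))" for z
          have "S (u \<epsilon> y) (Z \<epsilon>) = (\<Sum>z\<in>Z \<epsilon>. g z)"
            unfolding S_def
          proof (rule sum.cong[OF refl])
            fix z assume "z \<in> Z \<epsilon>"
            then have z: "z \<in> int_lattice" by (simp add: Z_def)
            have "u \<epsilon> y (z + \<rho>) - u \<epsilon> y z = f (z - v + \<rho>) - f (z - v)" if "\<rho> \<in> R" for \<rho>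
            proof -
              have "z + \<rho> \<in> int_lattice"
                using z that interaction_rangeD(2)[OF R] by (auto intro: int_lattice_add)
              then show ?thesis using z by (simp add: uf algebra_simps)
            qed
            then show "tensor_form R (shift_tensor K c) (\<lambda>\<rho>. u \<epsilon> y (z + \<rho>) - u \<epsilon> y z)
                (\<lambda>\<rho>. u \<epsilon> y (z + \<rho>) - u \<epsilon> y z) = g z"
              unfolding g_def by (intro tensor_form_cong)
          qed
          also have "\<dots> = (\<Sum>z\<in>(\<lambda>z. z + v) ` W. g z)"
          proof (rule sum.mono_neutral_right[OF finZ sub], rule ballI)
            fix z assume z: "z \<in> Z \<epsilon> - (\<lambda>z. z + v) ` W"
            then have "z - v \<notin> W" by (metis DiffD2 diff_add_cancel imageI)
            moreover have "z - v \<in> int_lattice" using z v(1) by (auto simp: Z_def intro: int_lattice_diff)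
            ultimately have "f (z - v + \<rho>) = 0" if "\<rho> \<in> insert 0 R" for \<rho> using supp that by blast
            from this this[of 0] show "g z = 0" 
              unfolding g_def by (subst tensor_form_cong[where A' = "\<lambda>_. 0" and B' = "\<lambda>_. 0"]) (auto simp: tensor_form_zero)
          qed
          also have "\<dots> = S f W" by (subst sum.reindex) (auto simp: g_def S_def)
          finally show ?thesis .
        qed
        finally show ?thesis .
      qed
    qed
  qed
qed

section \<open>The Legendre--Hadamard limit\<close>

text \<open>The leading term at k = 0 of the denominator of the Fourier quotient, and the
  \<eta>-factor in the denominator of \<open>lambda_LH_tilde\<close>.\<close>

definition phase_sum :: "(real ^ 'n::finite) set \<Rightarrow> real ^ 'n \<Rightarrow> real" where
  "phase_sum R k = (\<Sum>\<rho>\<in>R. (\<rho> \<bullet> k)\<^sup>2)"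

lemma phase_sum_nonneg: "0 \<le> phase_sum R k"
  by (simp add: phase_sum_def sum_nonneg)

lemma phase_sum_scaleR: "phase_sum R (t *\<^sub>R k) = t\<^sup>2 * phase_sum R k"
  by (simp add: phase_sum_def power_mult_distrib sum_distrib_left)

lemma phase_sum_pos:
  assumes R: "interaction_range R" and "k \<noteq> 0"
  shows "0 < phase_sum R k"
proof -
  obtain \<rho> where "\<rho> \<in> R" "\<rho> \<bullet> k \<noteq> 0" using ex_inner_nonzero[OF assms] by blast
  then show ?thesis
    unfolding phase_sum_def by (intro sum_pos2[OF interaction_rangeD(1)[OF R]]) auto
qed

text \<open>Compactness of the sphere gives a positive minimum, because R spans; homogeneity of
  degree two does the rest. This compares the two Legendre--Hadamard normalisations.\<close>

lemma phase_sum_coercive: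
  fixes R :: "(real ^ 'n::finite) set"
  assumes R: "interaction_range R"
  obtains \<kappa> where "\<kappa> > 0" "\<And>k. \<kappa> * (norm k)\<^sup>2 \<le> phase_sum R k"
proof -
  have "continuous_on (sphere 0 1) (phase_sum R)"
    unfolding phase_sum_def by (intro continuous_intros)
  moreover have "sphere (0 :: real ^ 'n) 1 \<noteq> {}" by simp
  ultimately obtain e where e: "e \<in> sphere 0 1" "\<And>k. k \<in> sphere 0 1 \<Longrightarrow> phase_sum R e \<le> phase_sum R k"
    using continuous_attains_inf[OF compact_sphere] by blast
  have "phase_sum R e * (norm k)\<^sup>2 \<le> phase_sum R k" for k
  proof (cases "k = 0")
    case True
    then show ?thesis by (simp add: phase_sum_nonneg)
  next
    case False
    then have "(1 / norm k) *\<^sub>R k \<in> sphere 0 1" by simp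
    from e(2)[OF this] False show ?thesis
      by (simp add: phase_sum_scaleR power_divide field_simps)
  qed
  moreover have "phase_sum R e > 0" using e(1) by (intro phase_sum_pos[OF R]) auto
  ultimately show ?thesis by (intro that)
qed

lemma matrix_form_outer:
  "matrix_form R K (outer \<xi> \<eta>) (outer \<xi> \<eta>)
     = tensor_form R K (\<lambda>\<rho>. (\<rho> \<bullet> \<eta>) *\<^sub>R \<xi>) (\<lambda>\<rho>. (\<rho> \<bullet> \<eta>) *\<^sub>R \<xi>)"
proof -
  have "outer \<xi> \<eta> *v \<rho> = (\<rho> \<bullet> \<eta>) *\<^sub>R \<xi>" for \<rho>
    by (simp add: vec_eq_iff outer_def matrix_vector_mult_def inner_vec_def sum_distrib_left
        sum_distrib_right mult_ac)
  then show ?thesis by (simp add: matrix_form_def)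
qed

lemma tensor_form_shift_rank_one:
  assumes "finite R"
  shows "tensor_form R (shift_tensor K c) (\<lambda>\<rho>. (\<rho> \<bullet> \<eta>) *\<^sub>R \<xi>) (\<lambda>\<rho>. (\<rho> \<bullet> \<eta>) *\<^sub>R \<xi>)
     = tensor_form R K (\<lambda>\<rho>. (\<rho> \<bullet> \<eta>) *\<^sub>R \<xi>) (\<lambda>\<rho>. (\<rho> \<bullet> \<eta>) *\<^sub>R \<xi>) - c * ((norm \<xi>)\<^sup>2 * phase_sum R \<eta>)"
  by (simp add: tensor_form_shift[OF assms] phase_sum_def power_mult_distrib sum_distrib_left mult_ac)

lemma le_lambda_LH_tilde_iff:
  fixes R :: "(real ^ 'n::finite) set"
  assumes R: "interaction_range R"
  shows "ereal c \<le> lambda_LH_tilde R K \<longleftrightarrow>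
     (\<forall>\<xi> \<eta>. 0 \<le> tensor_form R (shift_tensor K c) (\<lambda>\<rho>. (\<rho> \<bullet> \<eta>) *\<^sub>R \<xi>) (\<lambda>\<rho>. (\<rho> \<bullet> \<eta>) *\<^sub>R \<xi>))"
proof -
  define T where "T \<xi> \<eta> = tensor_form R (shift_tensor K c) (\<lambda>\<rho>. (\<rho> \<bullet> \<eta>) *\<^sub>R \<xi>) (\<lambda>\<rho>. (\<rho> \<bullet> \<eta>) *\<^sub>R \<xi>)" for \<xi> \<eta>
  have quot: "c \<le> matrix_form R K (outer \<xi> \<eta>) (outer \<xi> \<eta>) / ((norm \<xi>)\<^sup>2 * (\<Sum>\<rho>\<in>R. (\<rho> \<bullet> \<eta>)\<^sup>2)) \<longleftrightarrow> 0 \<le> T \<xi> \<eta>"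
    if "\<xi> \<in> UNIV - {0}" "\<eta> \<in> UNIV - {0}" for \<xi> \<eta>
  proof -
    have "(norm \<xi>)\<^sup>2 * phase_sum R \<eta> > 0" using that phase_sum_pos[OF R] by simp
    then show ?thesis
      unfolding phase_sum_def[symmetric] matrix_form_outer T_def
        tensor_form_shift_rank_one[OF interaction_rangeD(1)[OF R]]
      by (simp add: pos_le_divide_eq)
  qed
  have "ereal c \<le> lambda_LH_tilde R K \<longleftrightarrow> (\<forall>\<xi>\<in>UNIV - {0}. \<forall>\<eta>\<in>UNIV - {0}. 0 \<le> T \<xi> \<eta>)"
    unfolding lambda_LH_tilde_def le_INF_iff ereal_less_eq(3) by (intro ball_cong refl quot)
  also have "\<dots> \<longleftrightarrow> (\<forall>\<xi> \<eta>. 0 \<le> T \<xi> \<eta>)"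
  proof -
    have "T 0 \<eta> = 0" "T \<xi> 0 = 0" for \<xi> \<eta> by (simp_all add: T_def tensor_form_zero)
    then show ?thesis by (metis DiffI UNIV_I order_refl singletonD)
  qed
  finally show ?thesis by (simp add: T_def)
qed

text \<open>Coercivity of \<open>phase_sum\<close> bounds one denominator by a multiple of the
  other; positivity of c keeps the inequality in the right direction.\<close>

lemma lambda_LH_pos:
  fixes R :: "(real ^ 'n::finite) set"
  assumes R: "interaction_range R" and c: "c > 0" "ereal c \<le> lambda_LH_tilde R K"
  shows "0 < lambda_LH R K"
proof -
  obtain \<kappa> where \<kappa>: "\<kappa> > 0" "\<And>k. \<kappa> * (norm k)\<^sup>2 \<le> phase_sum R k"
    using phase_sum_coercive[OF R] by blast
  have "ereal (c * \<kappa>) \<le> lambda_LH R K"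
    unfolding lambda_LH_def le_INF_iff ereal_less_eq(3)
  proof (intro ballI)
    fix \<xi> \<eta> :: "real ^ 'n" assume nz: "\<xi> \<in> UNIV - {0}" "\<eta> \<in> UNIV - {0}"
    have "c * \<kappa> * ((norm \<xi>)\<^sup>2 * (norm \<eta>)\<^sup>2) = c * ((norm \<xi>)\<^sup>2 * (\<kappa> * (norm \<eta>)\<^sup>2))" by simp
    also have "\<dots> \<le> c * ((norm \<xi>)\<^sup>2 * phase_sum R \<eta>)"
      using \<kappa>(2)[of \<eta>] c(1) by (intro mult_left_mono) auto
    also have "\<dots> \<le> matrix_form R K (outer \<xi> \<eta>) (outer \<xi> \<eta>)"
      using c(2)[unfolded le_lambda_LH_tilde_iff[OF R], rule_format, of \<eta> \<xi>]
      by (simp add: matrix_form_outer tensor_form_shift_rank_one[OF interaction_rangeD(1)[OF R]])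
    finally show "c * \<kappa> \<le> matrix_form R K (outer \<xi> \<eta>) (outer \<xi> \<eta>) / ((norm \<xi>)\<^sup>2 * (norm \<eta>)\<^sup>2)"
      using nz by (simp add: pos_le_divide_eq)
  qed
  moreover have "0 < ereal (c * \<kappa>)" using c(1) \<kappa>(1) by simp
  ultimately show ?thesis by (rule less_le_trans[rotated])
qed

lemma norm_cis_approx:
  "norm (cis \<theta> - 1) \<le> \<bar>\<theta>\<bar>" "norm (cis \<theta> - 1 - \<i> * of_real \<theta>) \<le> \<theta>\<^sup>2"
  using Taylor_exp[of "\<i> * of_real \<theta>" 0] Taylor_exp[of "\<i> * of_real \<theta>" 1]
  by (simp_all add: cis_conv_exp norm_mult algebra_simps power2_eq_square)

text \<open>The symbol is replaced by its linearisation \<open>\<i> (\<rho> \<bullet> k)\<close>; the error is of third order in \<open>k\<close>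
  while both forms are of second order.\<close>

lemma cform_symb_approx:
  fixes w :: "complex ^ 'n::finite"
  assumes fin: "finite R"
  shows "\<bar>cform R K (\<lambda>\<rho>. symb k \<rho> *s w) (\<lambda>\<rho>. symb k \<rho> *s w)
      - (tensor_form R K (\<lambda>\<rho>. (\<rho> \<bullet> k) *\<^sub>R (\<chi> j. Re (w $ j))) (\<lambda>\<rho>. (\<rho> \<bullet> k) *\<^sub>R (\<chi> j. Re (w $ j)))
       + tensor_form R K (\<lambda>\<rho>. (\<rho> \<bullet> k) *\<^sub>R (\<chi> j. Im (w $ j))) (\<lambda>\<rho>. (\<rho> \<bullet> k) *\<^sub>R (\<chi> j. Im (w $ j))))\<bar>
    \<le> tensor_abs R K * (2 * (norm w)\<^sup>2 * (phase_sum R k * sqrt (phase_sum R k)))"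
proof -
  define S where "S = phase_sum R k"
  define a where "a = symb k"
  define b where "b \<rho> = \<i> * complex_of_real (\<rho> \<bullet> k)" for \<rho>
  have S: "0 \<le> S" by (simp add: S_def phase_sum_nonneg)
  \<comment> \<open>The factor \<i> of \<open>b\<close> is a common phase and drops out of the inner
    products, leaving the real factors \<rho> \<bullet> k on real and imaginary parts
    separately.\<close>
  have lin: "tensor_form R K (\<lambda>\<rho>. (\<rho> \<bullet> k) *\<^sub>R (\<chi> j. Re (w $ j))) (\<lambda>\<rho>. (\<rho> \<bullet> k) *\<^sub>R (\<chi> j. Re (w $ j)))
       + tensor_form R K (\<lambda>\<rho>. (\<rho> \<bullet> k) *\<^sub>R (\<chi> j. Im (w $ j))) (\<lambda>\<rho>. (\<rho> \<bullet> k) *\<^sub>R (\<chi> j. Im (w $ j)))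
     = cform R K (\<lambda>\<rho>. b \<rho> *s w) (\<lambda>\<rho>. b \<rho> *s w)"
    by (simp add: cform_def tensor_form_def b_def inner_complex_def algebra_simps flip: sum.distrib)
  have "(\<rho> \<bullet> k)\<^sup>2 \<le> S" if "\<rho> \<in> R" for \<rho>
    unfolding S_def phase_sum_def using that fin by (intro member_le_sum) auto
  then have phase: "(\<rho> \<bullet> k)\<^sup>2 \<le> S" "\<bar>\<rho> \<bullet> k\<bar> \<le> sqrt S" if "\<rho> \<in> R" for \<rho>
    using that by (auto intro: real_le_rsqrt)
  have na: "norm (a \<rho>) \<le> sqrt S" and nb: "norm (b \<rho>) \<le> sqrt S" and nab: "norm (a \<rho> - b \<rho>) \<le> S"
    if "\<rho> \<in> R" for \<rho>
    using phase[OF that] norm_cis_approx[of "\<rho> \<bullet> k"] by (auto simp: a_def b_def symb_def norm_mult)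
  have "\<bar>(a \<rho> *s w) $ j \<bullet> (a \<sigma> *s w) $ l - (b \<rho> *s w) $ j \<bullet> (b \<sigma> *s w) $ l\<bar>
      \<le> 2 * (norm w)\<^sup>2 * (S * sqrt S)" if "\<rho> \<in> R" "\<sigma> \<in> R" for j l \<rho> \<sigma>
  proof -
    have w: "norm (w $ i) \<le> norm w" for i by (rule Finite_Cartesian_Product.norm_nth_le)
    have prod: "\<bar>(x * w $ j) \<bullet> (y * w $ l)\<bar> \<le> (X * norm w) * (Y * norm w)"
      if "norm x \<le> X" "norm y \<le> Y" for x y X Y
    proof -
      have "0 \<le> X" "0 \<le> Y" using that norm_ge_zero order_trans by blast+
      then have "norm (x * w $ j) * norm (y * w $ l) \<le> (X * norm w) * (Y * norm w)"
        unfolding norm_mult using that w by (intro mult_mono) auto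
      then show ?thesis using Cauchy_Schwarz_ineq2 order_trans by blast
    qed
    \<comment> \<open>Telescoping: each of the two products contains one symbol error of size S and
      one factor of size \<open>sqrt S\<close>.\<close>
    have "(a \<rho> *s w) $ j \<bullet> (a \<sigma> *s w) $ l - (b \<rho> *s w) $ j \<bullet> (b \<sigma> *s w) $ l
        = ((a \<rho> - b \<rho>) * w $ j) \<bullet> (a \<sigma> * w $ l) + (b \<rho> * w $ j) \<bullet> ((a \<sigma> - b \<sigma>) * w $ l)"
      by (simp add: left_diff_distrib inner_diff_left inner_diff_right)
    also have "\<bar>\<dots>\<bar> \<le> (S * norm w) * (sqrt S * norm w) + (sqrt S * norm w) * (S * norm w)"
      by (intro order_trans[OF abs_triangle_ineq] add_mono prod na nb nab that)
    also have "\<dots> = 2 * (norm w)\<^sup>2 * (S * sqrt S)" by (simp add: power2_eq_square)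
    finally show ?thesis .
  qed
  from cform_diff_bound[of R "\<lambda>\<rho>. a \<rho> *s w" "\<lambda>\<rho>. a \<rho> *s w" "\<lambda>\<rho>. b \<rho> *s w" "\<lambda>\<rho>. b \<rho> *s w", OF this]
  show ?thesis unfolding lin by (simp add: a_def S_def)
qed

text \<open>Along the ray t \<eta> the linearised form is t^2 q and the error is of order t^3.
  Dividing by t^2 and letting t tend to 0 leaves q.\<close>

lemma rank_one_nonneg_if_symb_nonneg:
  fixes R :: "(real ^ 'n::finite) set"
  assumes fin: "finite R" and s: "s > 0"
    and nonneg: "\<And>k. norm k < s \<Longrightarrow> symb_nonneg R K k"
  shows "0 \<le> tensor_form R K (\<lambda>\<rho>. (\<rho> \<bullet> \<eta>) *\<^sub>R \<xi>) (\<lambda>\<rho>. (\<rho> \<bullet> \<eta>) *\<^sub>R \<xi>)"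
proof -
  define q where "q = tensor_form R K (\<lambda>\<rho>. (\<rho> \<bullet> \<eta>) *\<^sub>R \<xi>) (\<lambda>\<rho>. (\<rho> \<bullet> \<eta>) *\<^sub>R \<xi>)"
  define B where "B = tensor_abs R K * (2 * (norm (cvec \<xi>))\<^sup>2 * (phase_sum R \<eta> * sqrt (phase_sum R \<eta>)))"
  have bound: "0 \<le> q + B * t" if t: "0 < t" "t * norm \<eta> < s" for t
  proof -
    have "symb_nonneg R K (t *\<^sub>R \<eta>)" using t by (intro nonneg) simp
    then have n: "0 \<le> cform R K (\<lambda>\<rho>. symb (t *\<^sub>R \<eta>) \<rho> *s cvec \<xi>) (\<lambda>\<rho>. symb (t *\<^sub>R \<eta>) \<rho> *s cvec \<xi>)"
      by (simp add: symb_nonneg_def)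
    have re: "(\<chi> j. Re (cvec \<xi> $ j)) = \<xi>" and im: "(\<chi> j. Im (cvec \<xi> $ j)) = 0"
      by (simp_all add: cvec_def vec_eq_iff)
    have q: "tensor_form R K (\<lambda>\<rho>. (\<rho> \<bullet> (t *\<^sub>R \<eta>)) *\<^sub>R \<xi>) (\<lambda>\<rho>. (\<rho> \<bullet> (t *\<^sub>R \<eta>)) *\<^sub>R \<xi>) = t\<^sup>2 * q"
      using tensor_form_scaleR[of R K t "\<lambda>\<rho>. (\<rho> \<bullet> \<eta>) *\<^sub>R \<xi>"] by (simp add: q_def)
    have B: "tensor_abs R K * (2 * (norm (cvec \<xi>))\<^sup>2 * (phase_sum R (t *\<^sub>R \<eta>) * sqrt (phase_sum R (t *\<^sub>R \<eta>))))
        = t\<^sup>2 * (B * t)"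
      using t by (simp add: B_def phase_sum_scaleR real_sqrt_mult)
    have "0 \<le> t\<^sup>2 * (q + B * t)"
      using cform_symb_approx[OF fin, of K "t *\<^sub>R \<eta>" "cvec \<xi>"] n
      unfolding re im q B by (simp add: tensor_form_zero distrib_left)
    then show ?thesis using t by (simp add: zero_le_mult_iff)
  qed
  have "((\<lambda>t. q + B * t) \<longlongrightarrow> q + B * 0) (at_right 0)"
    by (intro tendsto_intros)
  moreover have "\<forall>\<^sub>F t in at_right 0. 0 \<le> q + B * t"
  proof (rule eventually_at_right[THEN iffD2])
    \<comment> \<open>The added 1 keeps the bound meaningful for \<eta> = 0.\<close>
    show "0 < s / (norm \<eta> + 1)" using s by (simp add: add_nonneg_pos)
    then show "\<exists>b>0. \<forall>t>0. t < b \<longrightarrow> 0 \<le> q + B * t"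
    proof (intro exI conjI allI impI)
      fix t :: real assume t: "0 < t" "t < s / (norm \<eta> + 1)"
      then have "t * (norm \<eta> + 1) < s" by (simp add: pos_less_divide_eq add_nonneg_pos)
      moreover have "t * norm \<eta> \<le> t * (norm \<eta> + 1)" using t by simp
      ultimately show "0 \<le> q + B * t" using t(1) by (intro bound) linarith+
    qed
  qed
  ultimately have "0 \<le> q + B * 0"
    by (intro tendsto_lowerbound[where F = "at_right (0::real)"]) auto
  then show ?thesis by (simp add: q_def)
qed

text \<open>Lowering the threshold from c' to c makes the linearised form at least (c' - c) S |w|^2,
  with S the phase sum. The linearisation error is 2 C S sqrt S |w|^2, hence absorbed once sqrt S is
  small, uniformly in w and in the direction of k.\<close>

lemma symb_nonneg_near_zero:
  fixes R :: "(real ^ 'n::finite) set"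
  assumes R: "interaction_range R" and c: "c < c'" "ereal c' \<le> lambda_LH_tilde R K"
  obtains \<delta> where "\<delta> > 0" "\<And>k. norm k < \<delta> \<Longrightarrow> symb_nonneg R (shift_tensor K c) k"
proof -
  note fin = interaction_rangeD(1)[OF R]
  define C where "C = tensor_abs R (shift_tensor K c)"
  have "((\<lambda>k. 2 * C * sqrt (phase_sum R k)) \<longlongrightarrow> 2 * C * sqrt (phase_sum R 0)) (nhds 0)"
    unfolding phase_sum_def by (intro tendsto_intros filterlim_ident)
  then have "\<forall>\<^sub>F k in nhds 0. 2 * C * sqrt (phase_sum R k) < c' - c"
  proof (rule order_tendstoD)
    show "2 * C * sqrt (phase_sum R 0) < c' - c" using c(1) by (simp add: phase_sum_def)
  qed
  then obtain \<delta> where \<delta>: "\<delta> > 0" "\<And>k. norm k < \<delta> \<Longrightarrow> 2 * C * sqrt (phase_sum R k) < c' - c"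
    by (auto simp: eventually_nhds_metric dist_norm)
  have "symb_nonneg R (shift_tensor K c) k" if "norm k < \<delta>" for k
    unfolding symb_nonneg_def
  proof
    fix w :: "complex ^ 'n"
    define S where "S = phase_sum R k"
    define T where "T c \<xi> = tensor_form R (shift_tensor K c) (\<lambda>\<rho>. (\<rho> \<bullet> k) *\<^sub>R \<xi>) (\<lambda>\<rho>. (\<rho> \<bullet> k) *\<^sub>R \<xi>)" for c \<xi>
    define x y where "x = (\<chi> j. Re (w $ j))" and "y = (\<chi> j. Im (w $ j))"
    have T: "T c \<xi> \<ge> (c' - c) * S * (norm \<xi>)\<^sup>2" for \<xi>
      using c(2)[unfolded le_lambda_LH_tilde_iff[OF R], rule_format, of k \<xi>]
      unfolding T_def tensor_form_shift_rank_one[OF fin] S_def by (simp add: algebra_simps)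
    have xy: "(norm x)\<^sup>2 + (norm y)\<^sup>2 = (norm w)\<^sup>2"
      unfolding power2_norm_eq_inner inner_vec_def x_def y_def
      by (simp add: inner_complex_def flip: sum.distrib)
    have "C * (2 * (norm w)\<^sup>2 * (S * sqrt S)) = (S * (norm w)\<^sup>2) * (2 * C * sqrt S)" by simp
    also have "\<dots> \<le> (S * (norm w)\<^sup>2) * (c' - c)"
      using \<delta>(2)[OF that] by (intro mult_left_mono) (auto simp: S_def phase_sum_nonneg)
    also have "\<dots> = (c' - c) * S * ((norm x)\<^sup>2 + (norm y)\<^sup>2)" by (simp add: xy)
    also have "\<dots> \<le> T c x + T c y" using T[of x] T[of y] by (simp add: distrib_left)
    finally show "0 \<le> cform R (shift_tensor K c) (\<lambda>\<rho>. symb k \<rho> *s w) (\<lambda>\<rho>. symb k \<rho> *s w)"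
      using cform_symb_approx[OF fin, of "shift_tensor K c" k w]
      unfolding T_def x_def y_def S_def C_def by linarith
  qed
  with \<delta>(1) show ?thesis by (rule that)
qed

text \<open>A real number lies strictly between any two different extended reals, so real thresholds
  decide equality, infinite values included.\<close>

lemma ereal_eqI_real_le:
  assumes "\<And>c. ereal c \<le> a \<longleftrightarrow> ereal c \<le> b"
  shows "a = b"
proof (rule antisym)
  show "a \<le> b"
  proof (rule ccontr)
    assume "\<not> a \<le> b"
    then obtain c where "b < ereal c" "ereal c < a" using ereal_dense2[of b a] by (auto simp: not_le)
    with assms[of c] show False by auto
  qed
  show "b \<le> a"
  proof (rule ccontr)
    assume "\<not> b \<le> a"
    then obtain c where "a < ereal c" "ereal c < b" using ereal_dense2[of a b] by (auto simp: not_le)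
    with assms[of c] show False by auto
  qed
qed

section \<open>Infima of the Fourier quotient over cubes and their limit\<close>

lemma symb_nonneg_zero: "symb_nonneg R K 0"
  by (simp add: symb_nonneg_def symb_def cform_def)

text \<open>The point 0 is excluded from the infimum but may be restored on the right, where all
  symbols vanish and the form is 0.\<close>

lemma le_INF_fourier_quotient_iff:
  assumes R: "interaction_range R"
    and sym: "\<And>j l \<rho> \<sigma>. \<rho> \<in> R \<Longrightarrow> \<sigma> \<in> R \<Longrightarrow> K j \<rho> l \<sigma> = K l \<sigma> j \<rho>"
    and small: "\<And>k i. k \<in> B \<Longrightarrow> \<bar>k $ i\<bar> < 2 * pi"
  shows "ereal c \<le> (INF k\<in>B - {0}. ereal (fourier_quotient R K k))
     \<longleftrightarrow> (\<forall>k\<in>B. symb_nonneg R (shift_tensor K c) k)"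
proof -
  have "ereal c \<le> (INF k\<in>B - {0}. ereal (fourier_quotient R K k))
      \<longleftrightarrow> (\<forall>k\<in>B - {0}. c \<le> fourier_quotient R K k)"
    unfolding le_INF_iff ereal_less_eq(3) ..
  also have "\<dots> \<longleftrightarrow> (\<forall>k\<in>B - {0}. symb_nonneg R (shift_tensor K c) k)"
  proof (rule ball_cong[OF refl])
    fix k assume k: "k \<in> B - {0}"
    show "c \<le> fourier_quotient R K k \<longleftrightarrow> symb_nonneg R (shift_tensor K c) k"
      by (rule le_fourier_quotient_iff[OF interaction_rangeD(1)[OF R] ex_symb_nonzero[OF R] sym])
        (use k small in auto)
  qed
  also have "\<dots> \<longleftrightarrow> (\<forall>k\<in>B. symb_nonneg R (shift_tensor K c) k)"
    using symb_nonneg_zero by blast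
  finally show ?thesis .
qed

lemma tendsto_INF_fourier_quotient:
  fixes R :: "(real ^ 'n::finite) set"
  assumes R: "interaction_range R"
    and sym: "\<And>j l \<rho> \<sigma>. \<rho> \<in> R \<Longrightarrow> \<sigma> \<in> R \<Longrightarrow> K j \<rho> l \<sigma> = K l \<sigma> j \<rho>"
  shows "((\<lambda>s. INF k\<in>{k. \<forall>i. - s < k $ i \<and> k $ i < s} - {0}. ereal (fourier_quotient R K k))
           \<longlongrightarrow> lambda_LH_tilde R K) (at_right (0::real))"
    (is "(?F \<longlongrightarrow> _) _")
proof (rule order_tendstoI)
  note fin = interaction_rangeD(1)[OF R]
  have ev: "\<forall>\<^sub>F s in at_right (0::real). 0 < s \<and> s < b" if "b > 0" for b
    using that by (auto simp: eventually_at_right)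
  have iff: "ereal c \<le> ?F s \<longleftrightarrow> (\<forall>k\<in>{k. \<forall>i. - s < k $ i \<and> k $ i < s}. symb_nonneg R (shift_tensor K c) k)"
    if "s < 2 * pi" for s c
    by (rule le_INF_fourier_quotient_iff[OF R sym])
      (use that in \<open>auto simp: abs_less_iff intro: less_trans minus_less_iff[THEN iffD1]\<close>)
  show "\<forall>\<^sub>F s in at_right 0. a < ?F s" if "a < lambda_LH_tilde R K" for a
  proof -
    \<comment> \<open>Two intermediate reals: c' is a lower bound for the Legendre--Hadamard
      constant, c < c' provides the margin for the linearisation, and a < c makes the conclusion
      strict.\<close>
    obtain c' where c': "a < ereal c'" "ereal c' < lambda_LH_tilde R K"
      using ereal_dense2[OF \<open>a < lambda_LH_tilde R K\<close>] by blast
    obtain c where c: "a < ereal c" "ereal c < ereal c'" using ereal_dense2[of a "ereal c'"] c'(1) by blast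
    then have "c < c'" by simp
    then obtain \<delta> where \<delta>: "\<delta> > 0" "\<And>k. norm k < \<delta> \<Longrightarrow> symb_nonneg R (shift_tensor K c) k"
      using symb_nonneg_near_zero[OF R] c'(2) by (metis less_imp_le)
    \<comment> \<open>Below 2 \<pi> the symbols do not all vanish away from 0; below \<delta> / d
      the cube lies in the ball of radius \<delta>, because the norm is at most the sum of the d
      coordinates in modulus.\<close>
    define b where "b = min (2 * pi) (\<delta> / CARD('n))"
    have "b > 0" using \<delta>(1) by (simp add: b_def)
    have "a < ?F s" if s: "0 < s \<and> s < b" for s
    proof -
      have "symb_nonneg R (shift_tensor K c) k" if k: "k \<in> {k. \<forall>i. - s < k $ i \<and> k $ i < s}" for k
      proof (rule \<delta>(2))
        have "norm k \<le> (\<Sum>i\<in>UNIV. \<bar>k $ i\<bar>)" by (rule norm_le_l1_cart)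
        also have "\<dots> \<le> (\<Sum>i\<in>(UNIV::'n set). s)"
          using k by (intro sum_mono) (auto simp: abs_le_iff minus_le_iff intro: less_imp_le)
        also have "\<dots> < \<delta>" using s by (simp add: b_def field_simps)
        finally show "norm k < \<delta>" .
      qed
      then have "ereal c \<le> ?F s" using s by (subst iff) (auto simp: b_def)
      with c(1) show ?thesis by (rule less_le_trans)
    qed
    then show ?thesis using ev[OF \<open>b > 0\<close>] by (rule eventually_mono[rotated])
  qed
  show "\<forall>\<^sub>F s in at_right 0. ?F s < a" if "lambda_LH_tilde R K < a" for a
  proof -
    \<comment> \<open>This side holds for every s below 2 \<pi>: a threshold beneath the infimum
      makes the symbol form nonnegative on a ball around 0, hence bounds the linearised constant
      from below.\<close>
    have "?F s < a" if s: "0 < s \<and> s < 2 * pi" for s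
    proof (rule ccontr)
      assume "\<not> ?F s < a"
      then obtain c where c: "lambda_LH_tilde R K < ereal c" "ereal c < ?F s"
        using ereal_dense2[OF \<open>lambda_LH_tilde R K < a\<close>] by (meson less_le_trans not_le)
      have nn: "\<forall>k\<in>{k. \<forall>i. - s < k $ i \<and> k $ i < s}. symb_nonneg R (shift_tensor K c) k"
        using c(2) s iff[of s c] by (meson less_imp_le)
      have "symb_nonneg R (shift_tensor K c) k" if "norm k < s" for k
      proof -
        have "\<bar>k $ i\<bar> < s" for i using component_le_norm_cart[of k i] that by linarith
        then have "\<forall>i. - s < k $ i \<and> k $ i < s" by (simp add: abs_less_iff minus_less_iff)
        with nn show ?thesis by blast
      qed
      then have "ereal c \<le> lambda_LH_tilde R K"
        unfolding le_lambda_LH_tilde_iff[OF R]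
        using rank_one_nonneg_if_symb_nonneg[OF fin, of s] s by blast
      with c(1) show False by simp
    qed
    then show ?thesis using ev[OF pi_gt_zero[THEN mult_pos_pos[OF zero_less_numeral]]]
      by (rule eventually_mono[rotated])
  qed
qed

theorem theorem3p6:
  fixes R \<Omega> :: "(real ^ 'n::finite) set" and K :: "'n rtensor"
  assumes "interaction_range R"
    and "\<And>j l \<rho> \<sigma>. \<rho> \<in> R \<Longrightarrow> \<sigma> \<in> R \<Longrightarrow> K j \<rho> l \<sigma> = K l \<sigma> j \<rho>"
    and "open \<Omega>" and "bounded \<Omega>" and "\<Omega> \<noteq> {}"
  shows "lambda_atom R \<Omega> K =
           (INF k\<in>{k. \<forall>i. 0 \<le> k $ i \<and> k $ i < 2 * pi} - {0}. ereal (fourier_quotient R K k))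
       \<and> ((\<lambda>s. INF k\<in>{k. \<forall>i. - s < k $ i \<and> k $ i < s} - {0}. ereal (fourier_quotient R K k))
           \<longlongrightarrow> lambda_LH_tilde R K) (at_right (0::real))
       \<and> (lambda_atom R \<Omega> K > 0 \<longrightarrow> lambda_LH R K > 0)"
proof (intro conjI impI)
  note R = assms(1) and sym = assms(2) and \<Omega> = assms(3-5)
  note fin = interaction_rangeD(1)[OF R] and lat = interaction_rangeD(2)[OF R]
  \<comment> \<open>Truncated waves give the symbol condition at every k, while grid averaging asks
    for it on the cube alone, so the two implications close up on the cube.\<close>
  have stable_iff: "lattice_stable R (shift_tensor K c) \<longleftrightarrow>
      (\<forall>k\<in>{k. \<forall>i. 0 \<le> k $ i \<and> k $ i < 2 * pi}. symb_nonneg R (shift_tensor K c) k)" for c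
    using lattice_stable_imp_symb_nonneg[OF fin lat] symb_nonneg_imp_lattice_stable[OF lat] by blast
  have cube_iff: "ereal c \<le> (INF k\<in>{k. \<forall>i. 0 \<le> k $ i \<and> k $ i < 2 * pi} - {0}. ereal (fourier_quotient R K k))
      \<longleftrightarrow> (\<forall>k\<in>{k. \<forall>i. 0 \<le> k $ i \<and> k $ i < 2 * pi}. symb_nonneg R (shift_tensor K c) k)" for c
    by (rule le_INF_fourier_quotient_iff[OF R sym]) auto
  show "lambda_atom R \<Omega> K =
      (INF k\<in>{k. \<forall>i. 0 \<le> k $ i \<and> k $ i < 2 * pi} - {0}. ereal (fourier_quotient R K k))"
    by (rule ereal_eqI_real_le) (simp only: le_lambda_atom_iff[OF R \<Omega>] stable_iff cube_iff)
  show "((\<lambda>s. INF k\<in>{k. \<forall>i. - s < k $ i \<and> k $ i < s} - {0}. ereal (fourier_quotient R K k))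
      \<longlongrightarrow> lambda_LH_tilde R K) (at_right (0::real))"
    by (rule tendsto_INF_fourier_quotient[OF R sym])
  assume "lambda_atom R \<Omega> K > 0"
  then obtain c where c: "0 < ereal c" "ereal c < lambda_atom R \<Omega> K" using ereal_dense2 by blast
  then have "lattice_stable R (shift_tensor K c)"
    using le_lambda_atom_iff[OF R \<Omega>, of c K] by (simp only: less_imp_le)
  \<comment> \<open>Stability gives the symbol condition at every frequency, in particular on the
    unit ball around 0; linearising there carries the same positive c over.\<close>
  then have "ereal c \<le> lambda_LH_tilde R K"
    unfolding le_lambda_LH_tilde_iff[OF R]
    using rank_one_nonneg_if_symb_nonneg[OF fin zero_less_one lattice_stable_imp_symb_nonneg[OF fin lat]]
    by blast
  with c(1) show "lambda_LH R K > 0" by (intro lambda_LH_pos[OF R]) simp_all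
qed

end
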